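(* If $f_1,f_2,\dots,f_N$ in $H^\infty(\Delta)$ satisfy, for some constant $\delta$, $$|f_1(z)|+|f_2(z)|+\cdots+|f_N(z)|\ge \delta>0,\qquad z\in\Delta,$$ then there exist $g_1,g_2,\dots,g_N$ in $H^\infty(\Delta)$ such that $$f_1(z)g_1(z)+f_2(z)g_2(z)+\cdots+f_N(z)g_N(z)= 1 \qquad\text{for all } z\in\Delta.$$
   Context: $\Delta$ is the open unit disc in $\mathbb{C}$, and $H^\infty(\Delta)$ is the algebra of bounded analytic functions on $\Delta$. *)

theory Defs
  imports "HOL-Complex_Analysis.Complex_Analysis"
begin

abbreviation unit_disc :: "complex set" where
  "unit_disc \<equiv> ball 0 1"

text \<open>Elements are total functions on the complex plane; only their values on the disc matter.\<close>

definition H_infinity :: "(complex \<Rightarrow> complex) set" where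
  "H_infinity = {f. f analytic_on unit_disc \<and> bounded (f ` unit_disc)}"

end

(*
By dilation, Taylor truncation and Montel's theorem it suffices to solve the equation, with bounds and
up to an arbitrarily high order at 0, for polynomials f_j. Write P for the Riesz projection. The
operator inequality |u|^2 <= C * sum |P(conj(f_j) u)|^2 on the Hardy space H^2 is proved as in Wolff's
argument: the smooth solution conj(f_j) / sum |f_k|^2 is corrected using Stokes' formula, and the area
integrals that arise are controlled by Littlewood-Paley estimates. The inequality makes
(sum f_j(z) conj(f_j(w)) - c^2) / (1 - z conj(w)) a positive kernel, and a lurking isometry argument in
finite dimensions (the Toeplitz corona theorem) produces solutions g_j bounded by 1/c.
*)

theory Submission
  imports Defs
begin

section \<open>Integration over the circle and the disc\<close>

text \<open>For polynomials every integrand is continuous on the closed disc, so no boundary values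
  and no limits in the Hardy space occur. The price is that all constants must be independent of the
  degrees and of the truncation order: \<open>a\<close>, \<open>b\<close> and \<open>c\<close>
  depend only on the number of functions and on their lower bound, and this is what makes the final
  compactness argument possible. No bounded solution of a dbar-equation is constructed. A lower
  bound for the adjoint operator is proved directly, and the passage from it to bounded solutions is
  linear algebra. Polynomials of degree at most \<open>n\<close> are invariant under the backward
  shift and under the adjoints of the multiplication operators, so the isometry argument can stay
  inside this space. What is lost is that the product is the constant \<open>c\<close> only modulo
  z^(n+1). The remaining coefficients grow at most linearly, so the error tends to 0 at each point
  of the open disc as \<open>n\<close> grows.\<close>

definition circ_int :: "(complex \<Rightarrow> 'a::banach) \<Rightarrow> 'a" where
  "circ_int F = integral {0..2*pi} (\<lambda>t. F (cis t))"

text \<open>Area measure in polar coordinates over a rectangle, with \<open>fst p\<close> as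
  Jacobian: Stokes' formula then reduces to the fundamental theorem of calculus in each
  variable.\<close>

definition area_int :: "(complex \<Rightarrow> 'a::banach) \<Rightarrow> 'a" where
  "area_int F = integral (cbox (0,0) (1,2*pi)) (\<lambda>p. fst p *\<^sub>R F (of_real (fst p) * cis (snd p)))"

lemma polar_in_cball:
  "p \<in> cbox (0,0) (1,2*pi) \<Longrightarrow> of_real (fst p) * cis (snd p) \<in> cball 0 1"
  by (cases p) (auto simp: norm_mult)

lemma continuous_on_polar:
  assumes "continuous_on (cball 0 1) F"
  shows "continuous_on (cbox (0,0) (1,2*pi)) (\<lambda>p. F (of_real (fst p) * cis (snd p)))"
  by (rule continuous_on_compose2[OF assms]) (auto intro!: continuous_intros polar_in_cball simp del: cbox_Pair_eq)

lemma circ_integrable: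
  fixes F :: "complex \<Rightarrow> 'a::banach"
  assumes "continuous_on (sphere 0 1) F"
  shows "(\<lambda>t. F (cis t)) integrable_on {0..2*pi}"
proof -
  have "continuous_on {0..2*pi} (\<lambda>t. F (cis t))"
    by (rule continuous_on_compose2[OF assms]) (auto intro!: continuous_intros)
  then show ?thesis
    using integrable_continuous_interval by blast
qed

lemma area_integrable:
  fixes F :: "complex \<Rightarrow> 'a::banach"
  assumes "continuous_on (cball 0 1) F"
  shows "(\<lambda>p. fst p *\<^sub>R F (of_real (fst p) * cis (snd p))) integrable_on cbox (0,0) (1,2*pi)"
  by (intro integrable_continuous continuous_intros continuous_on_polar assms)

lemma circ_int_add:
  assumes "continuous_on (sphere 0 1) F" "continuous_on (sphere 0 1) G"
  shows "circ_int (\<lambda>z. F z + G z) = circ_int F + circ_int G"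
  unfolding circ_int_def by (intro integral_add circ_integrable assms)

lemma circ_int_sum:
  assumes "finite I" "\<And>i. i \<in> I \<Longrightarrow> continuous_on (sphere 0 1) (F i)"
  shows "circ_int (\<lambda>z. \<Sum>i\<in>I. F i z) = (\<Sum>i\<in>I. circ_int (F i))"
  unfolding circ_int_def by (intro integral_sum circ_integrable assms)

lemma circ_int_cmul:
  fixes c :: real
  shows "circ_int (\<lambda>z. c * F z) = c * circ_int F"
  unfolding circ_int_def by simp

lemma circ_int_mono:
  fixes F G :: "complex \<Rightarrow> real"
  assumes "continuous_on (sphere 0 1) F" "continuous_on (sphere 0 1) G"
    and "\<And>z. norm z = 1 \<Longrightarrow> F z \<le> G z"
  shows "circ_int F \<le> circ_int G"
  unfolding circ_int_def by (intro integral_le circ_integrable assms) auto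

lemma circ_int_cong:
  assumes "\<And>z. norm z = 1 \<Longrightarrow> F z = G z"
  shows "circ_int F = circ_int G"
  unfolding circ_int_def using assms by (intro integral_cong) auto

lemma circ_int_norm_le:
  fixes F :: "complex \<Rightarrow> 'a::euclidean_space"
  assumes "continuous_on (sphere 0 1) F" "continuous_on (sphere 0 1) G"
    and "\<And>z. norm z = 1 \<Longrightarrow> norm (F z) \<le> G z"
  shows "norm (circ_int F) \<le> circ_int G"
  unfolding circ_int_def by (intro integral_norm_bound_integral circ_integrable assms) auto

lemma area_int_add:
  assumes "continuous_on (cball 0 1) F" "continuous_on (cball 0 1) G"
  shows "area_int (\<lambda>z. F z + G z) = area_int F + area_int G"
  unfolding area_int_def scaleR_add_right by (intro integral_add area_integrable assms)

lemma area_int_diff: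
  assumes "continuous_on (cball 0 1) F" "continuous_on (cball 0 1) G"
  shows "area_int (\<lambda>z. F z - G z) = area_int F - area_int G"
  unfolding area_int_def scaleR_diff_right by (intro integral_diff area_integrable assms)

lemma area_int_sum:
  assumes "finite I" "\<And>i. i \<in> I \<Longrightarrow> continuous_on (cball 0 1) (F i)"
  shows "area_int (\<lambda>z. \<Sum>i\<in>I. F i z) = (\<Sum>i\<in>I. area_int (F i))"
  unfolding area_int_def scaleR_sum_right by (intro integral_sum area_integrable assms)

lemma area_int_cmul:
  fixes c :: "'a::{real_normed_field,banach}"
  shows "area_int (\<lambda>z. c * F z) = c * area_int F"
  unfolding area_int_def by (simp flip: mult_scaleR_right)

lemma area_int_mono:
  fixes F G :: "complex \<Rightarrow> real"
  assumes "continuous_on (cball 0 1) F" "continuous_on (cball 0 1) G"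
    and "\<And>z. norm z \<le> 1 \<Longrightarrow> F z \<le> G z"
  shows "area_int F \<le> area_int G"
  unfolding area_int_def 
proof (intro integral_le area_integrable assms)
  fix p :: "real \<times> real" assume p: "p \<in> cbox (0,0) (1,2*pi)"
  then have "fst p \<ge> 0" by (cases p) auto
  then show "fst p *\<^sub>R F (of_real (fst p) * cis (snd p)) \<le> fst p *\<^sub>R G (of_real (fst p) * cis (snd p))"
    using polar_in_cball[OF p] by (intro scaleR_left_mono assms) auto
qed

lemma area_int_norm_le:
  fixes F :: "complex \<Rightarrow> 'a::euclidean_space"
  assumes "continuous_on (cball 0 1) F" "continuous_on (cball 0 1) G"
    and "\<And>z. norm z \<le> 1 \<Longrightarrow> norm (F z) \<le> G z"
  shows "norm (area_int F) \<le> area_int G"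
  unfolding area_int_def 
proof (intro integral_norm_bound_integral area_integrable assms)
  fix p :: "real \<times> real" assume p: "p \<in> cbox (0,0) (1,2*pi)"
  then have "fst p \<ge> 0" by (cases p) auto
  then show "norm (fst p *\<^sub>R F (of_real (fst p) * cis (snd p))) \<le> fst p *\<^sub>R G (of_real (fst p) * cis (snd p))"
    using assms(3)[of "of_real (fst p) * cis (snd p)"] polar_in_cball[OF p] by (auto intro!: mult_left_mono)
qed

lemma circ_int_of_real:
  assumes "continuous_on (sphere 0 1) F"
  shows "circ_int (\<lambda>z. complex_of_real (F z)) = of_real (circ_int F)"
  unfolding circ_int_def using integral_linear[OF circ_integrable[OF assms] bounded_linear_of_real[where 'a=complex]]
  by (simp add: o_def)

lemma area_int_of_real:
  assumes "continuous_on (cball 0 1) F"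
  shows "area_int (\<lambda>z. complex_of_real (F z)) = of_real (area_int F)"
  unfolding area_int_def using integral_linear[OF area_integrable[OF assms] bounded_linear_of_real[where 'a=complex]]
  by (simp add: o_def scaleR_conv_of_real)

lemma area_int_cnj:
  assumes "continuous_on (cball 0 1) F"
  shows "area_int (\<lambda>z. cnj (F z)) = cnj (area_int F)"
  unfolding area_int_def using integral_linear[OF area_integrable[OF assms] bounded_linear_cnj]
  by (simp add: o_def)

text \<open>In polar coordinates 2 r dbar Q = d/dr (r e^(it) Q) + i d/dt (e^(it) Q). The radial term
  integrates to the value on the circle, and the angular term integrates to 0 by periodicity.
  \<open>F1\<close> and \<open>F2\<close> are these two derivatives.\<close>

lemma stokes_disc:
  fixes Q :: "complex \<Rightarrow> complex"
  assumes der: "\<And>z. norm z \<le> 1 \<Longrightarrow> (Q has_derivative (\<lambda>h. A z * h + B z * cnj h)) (at z)"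
    and cA: "continuous_on (cball 0 1) A" and cB: "continuous_on (cball 0 1) B"
  shows "circ_int (\<lambda>z. z * Q z) = area_int (\<lambda>z. 2 * B z)"
proof -
  define P where "P r t = of_real r * cis t" for r t :: real
  have cQ: "continuous_on (cball 0 1) Q"
    using der has_derivative_continuous by (fastforce intro!: continuous_at_imp_continuous_on)
  define F1 where "F1 r t = cis t * Q (P r t) + of_real r * cis t * (A (P r t) * cis t + B (P r t) * cnj (cis t))" for r t
  define F2 where "F2 r t = \<i> * cis t * Q (P r t) + cis t * (A (P r t) * (of_real r * (\<i> * cis t)) + B (P r t) * cnj (of_real r * (\<i> * cis t)))" for r t
  have PB: "norm (P r t) \<le> 1" if "r \<in> {0..1}" for r t
    using that by (auto simp: P_def norm_mult)
  have pair: "F1 r t = -\<i> * F2 r t + r *\<^sub>R (2 * B (P r t))" for r t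
  proof -
    have "cis t * cnj (cis t) = 1" by (simp add: complex_norm_square[symmetric])
    then show ?thesis unfolding F1_def F2_def
      by (simp add: algebra_simps scaleR_conv_of_real) 
  qed
  note cp = cQ[THEN continuous_on_polar] cA[THEN continuous_on_polar] cB[THEN continuous_on_polar]
  have c1: "continuous_on (cbox (0,0) (1,2*pi)) (\<lambda>(r,t). F1 r t)"
    unfolding F1_def P_def case_prod_unfold by (intro continuous_intros cp)
  have c2: "continuous_on (cbox (0,0) (1,2*pi)) (\<lambda>(r,t). F2 r t)"
    unfolding F2_def P_def case_prod_unfold by (intro continuous_intros cp)
  have d1: "((\<lambda>r. F1 r t) has_integral (cis t * Q (cis t))) {0..1}" for t
  proof -
    have "((\<lambda>r. F1 r t) has_integral (of_real 1 * cis t * Q (P 1 t) - of_real 0 * cis t * Q (P 0 t))) {0..1}"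
    proof (rule fundamental_theorem_of_calculus)
      fix r :: real assume r: "r \<in> {0..1}"
      have "(Q has_derivative (\<lambda>h. A (P r t) * h + B (P r t) * cnj h)) (at (P r t) within (\<lambda>r. P r t) ` {0..1})"
        using der PB[OF r] has_derivative_at_withinI by blast
      moreover have "((\<lambda>r. P r t) has_vector_derivative cis t) (at r within {0..1})"
        unfolding P_def by (auto intro!: derivative_eq_intros)
      ultimately have "((\<lambda>r. Q (P r t)) has_vector_derivative (A (P r t) * cis t + B (P r t) * cnj (cis t))) (at r within {0..1})"
        using vector_derivative_diff_chain_within[of "\<lambda>r. P r t"] by (fastforce simp: o_def)
      then show "((\<lambda>r. of_real r * cis t * Q (P r t)) has_vector_derivative F1 r t) (at r within {0..1})"
        unfolding F1_def by (auto intro!: derivative_eq_intros)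
    qed auto
    then show ?thesis by (simp add: P_def)
  qed
  have d2: "(F2 r has_integral 0) {0..2*pi}" if r: "r \<in> {0..1}" for r
  proof -
    have "(F2 r has_integral (cis (2*pi) * Q (P r (2*pi)) - cis 0 * Q (P r 0))) {0..2*pi}"
    proof (rule fundamental_theorem_of_calculus)
      fix t :: real assume t: "t \<in> {0..2*pi}"
      have c: "(cis has_vector_derivative \<i> * cis t) (at t within {0..2*pi})"
        by (auto intro!: derivative_eq_intros simp: has_vector_derivative_def scaleR_conv_of_real)
      have "(Q has_derivative (\<lambda>h. A (P r t) * h + B (P r t) * cnj h)) (at (P r t) within (\<lambda>t. P r t) ` {0..2*pi})"
        using der PB[OF r] has_derivative_at_withinI by blast
      moreover have "((\<lambda>t. P r t) has_vector_derivative of_real r * (\<i> * cis t)) (at t within {0..2*pi})"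
        unfolding P_def using c by (auto intro!: derivative_eq_intros)
      ultimately have "((\<lambda>t. Q (P r t)) has_vector_derivative (A (P r t) * (of_real r * (\<i> * cis t)) + B (P r t) * cnj (of_real r * (\<i> * cis t)))) (at t within {0..2*pi})"
        using vector_derivative_diff_chain_within[of "\<lambda>t. P r t"] by (fastforce simp: o_def)
      then show "((\<lambda>t. cis t * Q (P r t)) has_vector_derivative F2 r t) (at t within {0..2*pi})"
        unfolding F2_def using c by (auto intro!: derivative_eq_intros)
    qed auto
    then show ?thesis by (simp add: P_def)
  qed
  have "circ_int (\<lambda>z. z * Q z) = integral {0..2*pi} (\<lambda>t. integral {0..1} (\<lambda>r. F1 r t))"
    unfolding circ_int_def using d1 by (intro integral_cong) (metis integral_unique)
  also have "\<dots> = integral {0..1} (\<lambda>r. integral {0..2*pi} (F1 r))"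
    using integral_swap_continuous[OF c1] by simp
  also have "\<dots> = integral (cbox (0,0) (1,2*pi)) (\<lambda>p. F1 (fst p) (snd p))"
    using integral_prod_continuous[OF c1] by (simp add: case_prod_unfold)
  also have "\<dots> = integral (cbox (0,0) (1,2*pi)) (\<lambda>p. -\<i> * F2 (fst p) (snd p)) + area_int (\<lambda>z. 2 * B z)"
    unfolding area_int_def pair P_def using c2
    by (intro integral_add area_integrable integrable_continuous continuous_intros cB) (auto simp: case_prod_unfold)
  also have "integral (cbox (0,0) (1,2*pi)) (\<lambda>p. -\<i> * F2 (fst p) (snd p)) = -\<i> * integral {0..1} (\<lambda>r. integral {0..2*pi} (F2 r))"
    using integral_prod_continuous[OF c2] by (simp add: case_prod_unfold)
  also have "integral {0..1} (\<lambda>r. integral {0..2*pi} (F2 r)) = integral {0..1} (\<lambda>r::real. 0::complex)"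
    using d2 by (intro integral_cong) (auto simp: integral_unique)
  finally show ?thesis by simp
qed

section \<open>Littlewood--Paley estimates\<close>

text \<open>\<open>a\<close> and \<open>b\<close> are the Wirtinger derivatives \<open>\<partial>Q\<close> and \<open>\<partial>Q\<close>-bar at \<open>z\<close>.\<close>

definition has_wirtinger :: "(complex \<Rightarrow> complex) \<Rightarrow> complex \<Rightarrow> complex \<Rightarrow> complex \<Rightarrow> bool" where
  "has_wirtinger Q a b z \<longleftrightarrow> (Q has_derivative (\<lambda>h. a * h + b * cnj h)) (at z)"

lemma has_wirtinger_holomorphic:
  "(p has_field_derivative d) (at z) \<Longrightarrow> has_wirtinger p d 0 z"
  by (simp add: has_wirtinger_def has_field_derivative_def)

lemma has_wirtinger_cnj:
  assumes "has_wirtinger Q a b z"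
  shows "has_wirtinger (\<lambda>z. cnj (Q z)) (cnj b) (cnj a) z"
  using bounded_linear.has_derivative[OF bounded_linear_cnj assms[unfolded has_wirtinger_def]]
  by (simp add: has_wirtinger_def add.commute)

lemma has_wirtinger_mult:
  assumes "has_wirtinger P a b z" "has_wirtinger Q c d z"
  shows "has_wirtinger (\<lambda>z. P z * Q z) (P z * c + a * Q z) (P z * d + b * Q z) z"
  using has_derivative_mult[OF assms[unfolded has_wirtinger_def]]
  by (simp add: has_wirtinger_def algebra_simps)

lemma has_wirtinger_diff:
  assumes "has_wirtinger P a b z" "has_wirtinger Q c d z"
  shows "has_wirtinger (\<lambda>z. P z - Q z) (a - c) (b - d) z"
  using has_derivative_diff[OF assms[unfolded has_wirtinger_def]]
  by (simp add: has_wirtinger_def algebra_simps)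

lemma has_wirtinger_sum:
  assumes "\<And>i. i \<in> I \<Longrightarrow> has_wirtinger (P i) (a i) (b i) z"
  shows "has_wirtinger (\<lambda>z. \<Sum>i\<in>I. P i z) (\<Sum>i\<in>I. a i) (\<Sum>i\<in>I. b i) z"
  using has_derivative_sum[of I P "\<lambda>i h. a i * h + b i * cnj h" "at z"] assms
  by (simp add: has_wirtinger_def sum.distrib sum_distrib_right)

lemma has_wirtinger_inverse:
  assumes "has_wirtinger P a b z" "P z \<noteq> 0"
  shows "has_wirtinger (\<lambda>z. inverse (P z)) (- a / (P z)^2) (- b / (P z)^2) z"
proof -
  have "((\<lambda>z. inverse (P z)) has_derivative (\<lambda>h. - (inverse (P z) * (a * h + b * cnj h) * inverse (P z)))) (at z)"
    using assms by (auto intro!: derivative_eq_intros simp: has_wirtinger_def)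
  then show ?thesis using assms(2)
    by (simp add: has_wirtinger_def divide_inverse power2_eq_square algebra_simps)
qed

lemma has_wirtinger_const: "has_wirtinger (\<lambda>z. c) 0 0 z"
  by (simp add: has_wirtinger_def)

lemma has_wirtinger_ident: "has_wirtinger (\<lambda>z. z) 1 0 z"
  by (simp add: has_wirtinger_def)

text \<open>Lets the introduction rules compute both derivatives as unknowns; the wanted expressions
  are matched by algebra afterwards.\<close>

lemma has_wirtinger_eqI:
  "has_wirtinger Q a b z \<Longrightarrow> a = a' \<Longrightarrow> b = b' \<Longrightarrow> has_wirtinger Q a' b' z"
  by simp

lemmas has_wirtinger_intros =
  has_wirtinger_cnj has_wirtinger_mult has_wirtinger_diff has_wirtinger_sum has_wirtinger_inverse
  has_wirtinger_const has_wirtinger_ident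

lemma has_wirtinger_deriv:
  assumes "p holomorphic_on UNIV"
  shows "has_wirtinger p (deriv p z) 0 z"
  using assms by (intro has_wirtinger_holomorphic holomorphic_derivI[where S=UNIV]) auto

lemma continuous_on_entire:
  fixes p :: "complex \<Rightarrow> complex"
  assumes "p holomorphic_on UNIV"
  shows "continuous_on S p" "continuous_on S (deriv p)" "continuous_on S (deriv (deriv p))"
  using assms by (meson holomorphic_deriv holomorphic_on_imp_continuous_on continuous_on_subset open_UNIV subset_UNIV)+

lemma continuous_on_has_wirtinger:
  assumes "\<And>z. z \<in> S \<Longrightarrow> has_wirtinger P (a z) (b z) z"
  shows "continuous_on S P"
  using assms has_derivative_continuous unfolding has_wirtinger_def
  by (metis continuous_at_imp_continuous_on)

text \<open>Stands in for the weight log (1/|z|) of the classical Littlewood-Paley identity: it also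
  vanishes on the circle, but is smooth at the origin.\<close>

definition disc_weight :: "complex \<Rightarrow> real" where
  "disc_weight z = 1 - (cmod z)\<^sup>2"

lemma disc_weight_conv: "complex_of_real (disc_weight z) = 1 - z * cnj z"
  by (simp add: disc_weight_def complex_norm_square[symmetric])

lemma disc_weight_bounds:
  assumes "cmod z \<le> 1"
  shows "0 \<le> disc_weight z" "disc_weight z \<le> 1"
  using assms power_le_one[of "cmod z" 2] by (auto simp: disc_weight_def)

lemma continuous_on_disc_weight [continuous_intros]: "continuous_on S disc_weight"
  unfolding disc_weight_def by (intro continuous_intros)

lemma wirtinger_disc_weight: "has_wirtinger (\<lambda>z. complex_of_real (disc_weight z)) (- cnj z) (- z) z"
  unfolding disc_weight_conv by (rule has_wirtinger_eqI, (rule has_wirtinger_intros)+) auto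

text \<open>
  Stokes' formula for \<open>z * H * G * (1 - |z|\<^sup>2)\<close>, which vanishes on the circle: the price of the weight
  needed for the Littlewood--Paley estimates is one more derivative.
\<close>

lemma area_by_parts:
  assumes H: "H holomorphic_on UNIV"
    and G: "\<And>z. norm z \<le> 1 \<Longrightarrow> has_wirtinger G (Gz z) (Gb z) z"
    and cG: "continuous_on (cball 0 1) Gz" "continuous_on (cball 0 1) Gb"
  shows "area_int (\<lambda>z. H z * G z) =
    area_int (\<lambda>z. of_real (disc_weight z) * (2 * H z * G z + z * deriv H z * G z + z * H z * Gz z))"
    (is "_ = area_int ?F")
proof -
  have cont: "continuous_on (cball 0 1) G"
    using G by (intro continuous_on_has_wirtinger) auto
  note cc = continuous_on_entire[OF H] cG cont
  define R where "R z = z * H z * G z * of_real (disc_weight z)" for z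
  \<comment> \<open>The derivative of the weight contributes -|z|^2 H G. Writing -|z|^2 as the
    weight minus 1 produces both the unweighted \<open>- H z * G z\<close> and the factor 2 in
    \<open>?F\<close>.\<close>
  define Rz where "Rz z = ?F z - H z * G z" for z
  define Rb where "Rb z = z * H z * Gb z * of_real (disc_weight z) - z * z * H z * G z" for z
  have cRz: "continuous_on (cball 0 1) Rz" unfolding Rz_def by (intro continuous_intros cc)
  have cRb: "continuous_on (cball 0 1) Rb" unfolding Rb_def by (intro continuous_intros cc)
  have dR: "has_wirtinger R (Rz z) (Rb z) z" if "norm z \<le> 1" for z
    unfolding R_def
    by (rule has_wirtinger_eqI, (rule has_wirtinger_intros has_wirtinger_deriv[OF H] G[OF that] wirtinger_disc_weight)+)
       (auto simp: Rz_def Rb_def disc_weight_conv algebra_simps)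
  \<comment> \<open>\<open>stokes_disc\<close> integrates only the \<open>cnj h\<close> part of a
    derivative; for the conjugate of \<open>R\<close> this part is the conjugate of
    \<open>Rz\<close>.\<close>
  have "circ_int (\<lambda>z. z * cnj (R z)) = area_int (\<lambda>z. 2 * cnj (Rz z))"
    by (rule stokes_disc[where A="\<lambda>z. cnj (Rb z)"])
       (use dR[THEN has_wirtinger_cnj] cRz cRb in \<open>auto simp: has_wirtinger_def intro!: continuous_intros\<close>)
  moreover have "circ_int (\<lambda>z. z * cnj (R z)) = circ_int (\<lambda>z. 0)"
    by (rule circ_int_cong) (simp add: R_def disc_weight_def)
  moreover have "circ_int (\<lambda>z. 0) = (0::complex)" by (simp add: circ_int_def)
  moreover have "area_int (\<lambda>z. 2 * cnj (Rz z)) = 2 * cnj (area_int Rz)"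
    using area_int_cnj[OF cRz] by (simp add: area_int_cmul)
  ultimately have "area_int Rz = 0" by simp
  moreover have "area_int Rz = area_int ?F - area_int (\<lambda>z. H z * G z)"
    unfolding Rz_def by (intro area_int_diff continuous_intros cc)
  ultimately show ?thesis by simp
qed

text \<open>Two instances of Stokes' formula share the area integral of \<open>T\<close>. For p' *
  cnj p times the weight, the circle side vanishes and \<open>T\<close> is traded for the weighted
  |p'|^2; for \<open>cnj z\<close> times |p|^2, the circle side is the norm of \<open>p\<close>.
  Eliminating \<open>T\<close> gives the identity.\<close>

lemma littlewood_paley:
  assumes p: "p holomorphic_on UNIV"
  shows "area_int (\<lambda>z. disc_weight z * (cmod (deriv p z))\<^sup>2) + area_int (\<lambda>z. (cmod (p z))\<^sup>2)
       = circ_int (\<lambda>z. (cmod (p z))\<^sup>2) / 2"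
proof -
  have p': "deriv p holomorphic_on UNIV" using p by (intro holomorphic_deriv) auto
  note cc = continuous_on_entire[OF p]
  define T where "T z = z * deriv p z * cnj (p z)" for z
  define E where "E z = of_real (disc_weight z) * (deriv p z * cnj (deriv p z))" for z
  have cT: "continuous_on (cball 0 1) T" unfolding T_def by (intro continuous_intros cc)
  have cE: "continuous_on (cball 0 1) E" unfolding E_def by (intro continuous_intros cc)
  have "circ_int (\<lambda>z. z * (deriv p z * cnj (p z) * of_real (disc_weight z))) = area_int (\<lambda>z. 2 * (E z - T z))"
  proof (rule stokes_disc[where A="\<lambda>z. deriv (deriv p) z * cnj (p z) * of_real (disc_weight z) - deriv p z * cnj (p z) * cnj z"], fold has_wirtinger_def)
    show "has_wirtinger (\<lambda>z. deriv p z * cnj (p z) * complex_of_real (disc_weight z))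
          (deriv (deriv p) z * cnj (p z) * of_real (disc_weight z) - deriv p z * cnj (p z) * cnj z)
          (E z - T z) z" for z
      by (rule has_wirtinger_eqI, (rule has_wirtinger_intros has_wirtinger_deriv[OF p] has_wirtinger_deriv[OF p'] wirtinger_disc_weight)+)
         (auto simp: E_def T_def algebra_simps)
  qed (auto simp: E_def T_def intro!: continuous_intros cc)
  moreover have "circ_int (\<lambda>z. z * (deriv p z * cnj (p z) * of_real (disc_weight z))) = circ_int (\<lambda>z. 0)"
    by (rule circ_int_cong) (simp add: disc_weight_def)
  moreover have "circ_int (\<lambda>z. 0) = (0::complex)" by (simp add: circ_int_def)
  moreover have "area_int (\<lambda>z. 2 * (E z - T z)) = 2 * (area_int E - area_int T)"
    using area_int_diff[OF cE cT] by (simp only: area_int_cmul)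
  ultimately have ET: "area_int E = area_int T" by simp
  have "circ_int (\<lambda>z. z * (cnj z * (p z * cnj (p z)))) = area_int (\<lambda>z. 2 * (p z * cnj (p z) + cnj (T z)))"
  proof (rule stokes_disc[where A="\<lambda>z. cnj z * deriv p z * cnj (p z)"], fold has_wirtinger_def)
    show "has_wirtinger (\<lambda>z. cnj z * (p z * cnj (p z))) (cnj z * deriv p z * cnj (p z)) (p z * cnj (p z) + cnj (T z)) z" for z
      by (rule has_wirtinger_eqI, (rule has_wirtinger_intros has_wirtinger_deriv[OF p])+)
         (auto simp: T_def algebra_simps)
  qed (auto simp: T_def intro!: continuous_intros cc)
  moreover have "circ_int (\<lambda>z. z * (cnj z * (p z * cnj (p z)))) = circ_int (\<lambda>z. complex_of_real ((cmod (p z))\<^sup>2))"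
  proof (rule circ_int_cong)
    fix z :: complex assume "norm z = 1"
    then have "z * cnj z = 1" by (simp add: complex_norm_square[symmetric])
    then show "z * (cnj z * (p z * cnj (p z))) = complex_of_real ((cmod (p z))\<^sup>2)"
      by (metis complex_norm_square mult.assoc mult_1)
  qed
  moreover have "\<dots> = of_real (circ_int (\<lambda>z. (cmod (p z))\<^sup>2))"
    by (intro circ_int_of_real continuous_intros cc)
  moreover have "area_int (\<lambda>z. 2 * (p z * cnj (p z) + cnj (T z))) = 2 * area_int (\<lambda>z. p z * cnj (p z) + cnj (T z))"
    by (rule area_int_cmul)
  moreover have "\<dots> = 2 * (area_int (\<lambda>z. p z * cnj (p z)) + cnj (area_int T))"
    by (subst area_int_add) (auto intro!: continuous_intros cc cT simp: area_int_cnj[OF cT])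
  moreover have "area_int (\<lambda>z. p z * cnj (p z)) = of_real (area_int (\<lambda>z. (cmod (p z))\<^sup>2))"
    by (subst area_int_of_real[symmetric]) (auto simp: complex_norm_square[symmetric] intro!: continuous_intros cc)
  moreover have "area_int E = of_real (area_int (\<lambda>z. disc_weight z * (cmod (deriv p z))\<^sup>2))"
    unfolding E_def
    by (subst area_int_of_real[symmetric]) (auto simp: complex_norm_square[symmetric] intro!: continuous_intros cc)
  ultimately have "complex_of_real (circ_int (\<lambda>z. (cmod (p z))\<^sup>2)) =
     of_real (2 * (area_int (\<lambda>z. (cmod (p z))\<^sup>2) + area_int (\<lambda>z. disc_weight z * (cmod (deriv p z))\<^sup>2)))"
    using ET by simp
  then show ?thesis unfolding of_real_eq_iff by simp
qed

lemma area_int_nonneg: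
  assumes "continuous_on (cball 0 1) F" "\<And>z. norm z \<le> 1 \<Longrightarrow> 0 \<le> F z"
  shows "0 \<le> (area_int F :: real)"
  using area_int_mono[of "\<lambda>z. 0" F] assms by (simp add: area_int_def)

lemma area_deriv_bound:
  assumes p: "p holomorphic_on UNIV"
  shows "area_int (\<lambda>z. disc_weight z * (cmod (deriv p z))\<^sup>2) \<le> circ_int (\<lambda>z. (cmod (p z))\<^sup>2) / 2"
proof -
  have "0 \<le> area_int (\<lambda>z. (cmod (p z))\<^sup>2)"
    by (intro area_int_nonneg continuous_intros continuous_on_entire[OF p]) auto
  then show ?thesis using littlewood_paley[OF p] by linarith
qed

lemma area_bound:
  assumes p: "p holomorphic_on UNIV"
  shows "area_int (\<lambda>z. disc_weight z * (cmod (p z))\<^sup>2) \<le> circ_int (\<lambda>z. (cmod (p z))\<^sup>2) / 2"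
proof -
  note cc = continuous_intros continuous_on_entire[OF p]
  have "0 \<le> area_int (\<lambda>z. disc_weight z * (cmod (deriv p z))\<^sup>2)"
    by (intro area_int_nonneg cc) (simp add: disc_weight_bounds)
  moreover have "area_int (\<lambda>z. disc_weight z * (cmod (p z))\<^sup>2) \<le> area_int (\<lambda>z. (cmod (p z))\<^sup>2)"
    by (intro area_int_mono cc) (simp add: disc_weight_bounds mult_left_le_one_le)
  ultimately show ?thesis using littlewood_paley[OF p] by linarith
qed

text \<open>
  The Carleson measure property of \<open>|f'|\<^sup>2 (1 - |z|\<^sup>2)\<close> for bounded \<open>f\<close>, obtained from
  \<open>g f' = (f g)' - f g'\<close> and the Littlewood--Paley estimate for \<open>f g\<close> and \<open>g\<close>.
\<close>

lemma carleson_bound: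
  assumes f: "f holomorphic_on UNIV" and g: "g holomorphic_on UNIV"
    and b: "\<And>z. norm z \<le> 1 \<Longrightarrow> norm (f z) \<le> 1"
  shows "area_int (\<lambda>z. disc_weight z * ((cmod (g z))\<^sup>2 * (cmod (deriv f z))\<^sup>2)) \<le> 2 * circ_int (\<lambda>z. (cmod (g z))\<^sup>2)"
proof -
  note cf = continuous_on_entire[OF f] and cg = continuous_on_entire[OF g]
  have fg: "(\<lambda>z. f z * g z) holomorphic_on UNIV" by (intro holomorphic_intros f g)
  note cc = continuous_intros cf cg continuous_on_entire[OF fg]
  have "area_int (\<lambda>z. disc_weight z * ((cmod (g z))\<^sup>2 * (cmod (deriv f z))\<^sup>2)) \<le>
        area_int (\<lambda>z. 2 * (disc_weight z * (cmod (deriv (\<lambda>z. f z * g z) z))\<^sup>2) + 2 * (disc_weight z * (cmod (deriv g z))\<^sup>2))"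
  proof (intro area_int_mono cc)
    fix z :: complex assume z: "norm z \<le> 1"
    have "deriv (\<lambda>z. f z * g z) z = f z * deriv g z + deriv f z * g z"
      using f g by (intro deriv_mult holomorphic_on_imp_differentiable_at) auto
    then have "cmod (g z * deriv f z) = cmod (deriv (\<lambda>z. f z * g z) z - f z * deriv g z)" by (simp add: algebra_simps)
    also have "\<dots> \<le> cmod (deriv (\<lambda>z. f z * g z) z) + cmod (f z * deriv g z)" by (rule norm_triangle_ineq4)
    also have "cmod (f z * deriv g z) \<le> cmod (deriv g z)"
      using b[OF z] by (simp add: norm_mult mult_left_le_one_le)
    finally have "(cmod (g z * deriv f z))\<^sup>2 \<le> (cmod (deriv (\<lambda>z. f z * g z) z) + cmod (deriv g z))\<^sup>2"
      by (intro power_mono) auto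
    also have "\<dots> \<le> 2 * (cmod (deriv (\<lambda>z. f z * g z) z))\<^sup>2 + 2 * (cmod (deriv g z))\<^sup>2"
      using sum_squares_bound[of "cmod (deriv (\<lambda>z. f z * g z) z)" "cmod (deriv g z)"] by (simp add: power2_sum)
    finally have "disc_weight z * (cmod (g z * deriv f z))\<^sup>2 \<le> disc_weight z * (2 * (cmod (deriv (\<lambda>z. f z * g z) z))\<^sup>2 + 2 * (cmod (deriv g z))\<^sup>2)"
      using disc_weight_bounds[OF z] by (intro mult_left_mono) auto
    then show "disc_weight z * ((cmod (g z))\<^sup>2 * (cmod (deriv f z))\<^sup>2) \<le>
       2 * (disc_weight z * (cmod (deriv (\<lambda>z. f z * g z) z))\<^sup>2) + 2 * (disc_weight z * (cmod (deriv g z))\<^sup>2)"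
      by (simp add: norm_mult power_mult_distrib algebra_simps)
  qed
  also have "\<dots> = 2 * area_int (\<lambda>z. disc_weight z * (cmod (deriv (\<lambda>z. f z * g z) z))\<^sup>2) + 2 * area_int (\<lambda>z. disc_weight z * (cmod (deriv g z))\<^sup>2)"
    by (subst area_int_add) (auto simp: area_int_cmul intro!: cc)
  also have "\<dots> \<le> circ_int (\<lambda>z. (cmod (f z * g z))\<^sup>2) + circ_int (\<lambda>z. (cmod (g z))\<^sup>2)"
    using area_deriv_bound[OF fg] area_deriv_bound[OF g] by linarith
  also have "circ_int (\<lambda>z. (cmod (f z * g z))\<^sup>2) \<le> circ_int (\<lambda>z. (cmod (g z))\<^sup>2)"
    by (intro circ_int_mono cc) (simp add: norm_mult power_mult_distrib mult_left_le_one_le b power_le_one)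
  finally show ?thesis by simp
qed

section \<open>The corona estimate in the Hardy space\<close>

text \<open>The weight \<open>t\<close> stays free through all estimates and is fixed only at the
  very end, so that the contribution of \<open>u\<close> can be absorbed on the left.\<close>

lemma am_gm_weighted:
  fixes a b t :: real
  assumes "t > 0"
  shows "a * b \<le> t * a\<^sup>2 + b\<^sup>2 / t" "2 * (a * b) \<le> t * a\<^sup>2 + b\<^sup>2 / t"
proof -
  have "0 \<le> (t * a - b)\<^sup>2 / t" using assms by simp
  also have "\<dots> = t * a\<^sup>2 - 2 * (a * b) + b\<^sup>2 / t"
    using assms by (simp add: power2_diff field_simps power2_eq_square)
  finally show 2: "2 * (a * b) \<le> t * a\<^sup>2 + b\<^sup>2 / t" by simp
  have "0 \<le> t * a\<^sup>2 + b\<^sup>2 / t" using assms by simp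
  with 2 show "a * b \<le> t * a\<^sup>2 + b\<^sup>2 / t" by (cases "a * b \<ge> 0") linarith+
qed

text \<open>The hypotheses on \<open>a\<close> and \<open>b\<close> say that their squares, times
  the weight, are Carleson densities. After \<open>area_by_parts\<close> every term is a product of
  one factor from \<open>u\<close> and one from \<open>\<psi>\<close>, each being the function, its
  derivative, or the function times \<open>a\<close> or \<open>b\<close>. AM-GM separates the two
  factors, and each square is controlled by Littlewood-Paley or by a Carleson bound. For
  \<open>u\<close> the constant is 1/2 + 1/2 + 2\<alpha>; for \<open>\<psi>\<close> it is 2\<alpha>
  + 1/2 + \<beta> with the 1/2 rounded up.\<close>

lemma area_bilinear_bound:
  fixes u \<psi> G Gz Gb :: "complex \<Rightarrow> complex" and a b :: "complex \<Rightarrow> real"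
  assumes u: "u holomorphic_on UNIV" and \<psi>: "\<psi> holomorphic_on UNIV"
    and G: "\<And>z. norm z \<le> 1 \<Longrightarrow> has_wirtinger G (Gz z) (Gb z) z"
    and cG: "continuous_on (cball 0 1) Gz" "continuous_on (cball 0 1) Gb"
    and ca: "continuous_on (cball 0 1) a" and cb: "continuous_on (cball 0 1) b"
    and ab0: "\<And>z. 0 \<le> a z" "\<And>z. 0 \<le> b z" and e: "0 \<le> e" and t: "t > 0"
    and Ga: "\<And>z. norm z \<le> 1 \<Longrightarrow> norm (G z) \<le> e * a z"
    and Gab: "\<And>z. norm z \<le> 1 \<Longrightarrow> norm (Gz z) \<le> e * (a z * b z)"
    and a: "\<And>g. g holomorphic_on UNIV \<Longrightarrow>
      area_int (\<lambda>z. disc_weight z * ((cmod (g z))\<^sup>2 * (a z)\<^sup>2)) \<le> \<alpha> * circ_int (\<lambda>z. (cmod (g z))\<^sup>2)"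
    and b: "\<And>g. g holomorphic_on UNIV \<Longrightarrow>
      area_int (\<lambda>z. disc_weight z * ((cmod (g z))\<^sup>2 * (b z)\<^sup>2)) \<le> \<beta> * circ_int (\<lambda>z. (cmod (g z))\<^sup>2)"
  shows "norm (area_int (\<lambda>z. u z * \<psi> z * G z)) \<le>
    e * (t * ((1 + 2 * \<alpha>) * circ_int (\<lambda>z. (cmod (u z))\<^sup>2)) + ((1 + 2 * \<alpha> + \<beta>) * circ_int (\<lambda>z. (cmod (\<psi> z))\<^sup>2)) / t)"
proof -
  define H where "H z = u z * \<psi> z" for z
  have H: "H holomorphic_on UNIV" unfolding H_def by (intro holomorphic_intros u \<psi>)
  have dH: "deriv H z = u z * deriv \<psi> z + deriv u z * \<psi> z" for z
    unfolding H_def using u \<psi> by (intro deriv_mult holomorphic_on_imp_differentiable_at) auto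
  have cont: "continuous_on (cball 0 1) G"
    using G by (intro continuous_on_has_wirtinger) auto
  note cc = continuous_intros cont cG ca cb continuous_on_entire[OF H] continuous_on_entire[OF u] continuous_on_entire[OF \<psi>]
  \<comment> \<open>\<open>U\<close> and \<open>V\<close> gather the squares that AM-GM produces
    from \<open>u\<close> and from \<open>\<psi>\<close>. The split is asymmetric: in the term with
    \<open>b\<close>, the factor \<open>a\<close> goes to \<open>u\<close> and \<open>b\<close> to
    \<open>\<psi>\<close>.\<close>
  define U where "U z = (cmod (u z))\<^sup>2 + (cmod (deriv u z))\<^sup>2 + 2 * ((cmod (u z))\<^sup>2 * (a z)\<^sup>2)" for z
  define V where "V z = 2 * ((cmod (\<psi> z))\<^sup>2 * (a z)\<^sup>2) + (cmod (deriv \<psi> z))\<^sup>2 + (cmod (\<psi> z))\<^sup>2 * (b z)\<^sup>2" for z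
  have cU: "continuous_on (cball 0 1) (\<lambda>z. disc_weight z * U z)" unfolding U_def by (intro cc)
  have cV: "continuous_on (cball 0 1) (\<lambda>z. disc_weight z * V z)" unfolding V_def by (intro cc)
  have parts: "area_int (\<lambda>z. H z * G z) = area_int (\<lambda>z. of_real (disc_weight z) * (2 * H z * G z + z * deriv H z * G z + z * H z * Gz z))"
    by (rule area_by_parts[OF H G cG])
  have "norm (area_int (\<lambda>z. H z * G z)) \<le> area_int (\<lambda>z. e * (t * (disc_weight z * U z) + (1/t) * (disc_weight z * V z)))"
    unfolding parts
  proof (intro area_int_norm_le cU cV cc)
    fix z :: complex assume z: "norm z \<le> 1"
    let ?F = "2 * H z * G z + z * deriv H z * G z + z * H z * Gz z"
    have "norm ?F \<le> 2 * norm (H z) * norm (G z) + norm z * (norm (deriv H z) * norm (G z)) + norm z * (norm (H z) * norm (Gz z))"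
      by (intro norm_triangle_le add_mono) (auto simp: norm_mult mult.assoc)
    also have "\<dots> \<le> 2 * norm (H z) * norm (G z) + norm (deriv H z) * norm (G z) + norm (H z) * norm (Gz z)"
      using z by (intro add_mono order.refl mult_left_le_one_le) auto
    also have "\<dots> \<le> 2 * norm (H z) * (e * a z) + norm (deriv H z) * (e * a z) + norm (H z) * (e * (a z * b z))"
      using Ga[OF z] Gab[OF z] by (intro add_mono mult_left_mono) auto
    also have "\<dots> = e * (2 * (norm (H z) * a z) + norm (deriv H z) * a z + norm (H z) * (a z * b z))"
      by (simp add: algebra_simps)
    also have "\<dots> \<le> e * (t * U z + (1/t) * V z)"
    proof (intro mult_left_mono e)
      have "norm (deriv H z) * a z \<le> (norm (u z) * norm (deriv \<psi> z) + norm (deriv u z) * norm (\<psi> z)) * a z"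
        unfolding dH using ab0 by (intro mult_right_mono norm_triangle_le) (auto simp: norm_mult)
      also have "\<dots> = (norm (u z) * a z) * norm (deriv \<psi> z) + norm (deriv u z) * (norm (\<psi> z) * a z)"
        by (simp add: algebra_simps)
      also have "\<dots> \<le> (t * (norm (u z) * a z)\<^sup>2 + (norm (deriv \<psi> z))\<^sup>2 / t) + (t * (norm (deriv u z))\<^sup>2 + (norm (\<psi> z) * a z)\<^sup>2 / t)"
        by (intro add_mono am_gm_weighted t)
      finally have 1: "norm (deriv H z) * a z \<le> \<dots>" .
      have 2: "2 * (norm (H z) * a z) \<le> t * (norm (u z))\<^sup>2 + (norm (\<psi> z) * a z)\<^sup>2 / t"
        using am_gm_weighted(2)[OF t, of "norm (u z)" "norm (\<psi> z) * a z"] by (simp add: H_def norm_mult mult.assoc)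
      have 3: "norm (H z) * (a z * b z) \<le> t * (norm (u z) * a z)\<^sup>2 + (norm (\<psi> z) * b z)\<^sup>2 / t"
        using am_gm_weighted(1)[OF t, of "norm (u z) * a z" "norm (\<psi> z) * b z"] by (simp add: H_def norm_mult mult_ac)
      have "2 * (norm (H z) * a z) + norm (deriv H z) * a z + norm (H z) * (a z * b z) \<le>
         (t * (norm (u z))\<^sup>2 + (norm (\<psi> z) * a z)\<^sup>2 / t) +
         ((t * (norm (u z) * a z)\<^sup>2 + (norm (deriv \<psi> z))\<^sup>2 / t) + (t * (norm (deriv u z))\<^sup>2 + (norm (\<psi> z) * a z)\<^sup>2 / t)) +
         (t * (norm (u z) * a z)\<^sup>2 + (norm (\<psi> z) * b z)\<^sup>2 / t)"
        using 1 2 3 by linarith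
      also have "\<dots> = t * U z + (1/t) * V z"
        by (simp add: U_def V_def power_mult_distrib add_divide_distrib ring_distribs)
      finally show "2 * (norm (H z) * a z) + norm (deriv H z) * a z + norm (H z) * (a z * b z) \<le> t * U z + (1/t) * V z" .
    qed
    finally have "norm ?F \<le> e * (t * U z + (1/t) * V z)" .
    then have "disc_weight z * norm ?F \<le> disc_weight z * (e * (t * U z + (1/t) * V z))"
      using disc_weight_bounds[OF z] by (intro mult_left_mono) auto
    then show "norm (complex_of_real (disc_weight z) * ?F) \<le> e * (t * (disc_weight z * U z) + (1/t) * (disc_weight z * V z))"
      unfolding norm_mult[of "complex_of_real (disc_weight z)"] using disc_weight_bounds[OF z]
      by (simp add: algebra_simps del: times_divide_eq_left)
  qed
  also have "\<dots> = e * (t * area_int (\<lambda>z. disc_weight z * U z) + (1/t) * area_int (\<lambda>z. disc_weight z * V z))"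
    unfolding area_int_cmul by (subst area_int_add) (auto simp: area_int_cmul intro!: cc cU cV simp del: times_divide_eq_left)
  also have "\<dots> \<le> e * (t * ((1 + 2 * \<alpha>) * circ_int (\<lambda>z. (cmod (u z))\<^sup>2)) + (1/t) * ((1 + 2 * \<alpha> + \<beta>) * circ_int (\<lambda>z. (cmod (\<psi> z))\<^sup>2)))"
  proof (intro mult_left_mono add_mono e)
    have "area_int (\<lambda>z. disc_weight z * U z) = area_int (\<lambda>z. disc_weight z * (cmod (u z))\<^sup>2)
       + area_int (\<lambda>z. disc_weight z * (cmod (deriv u z))\<^sup>2) + 2 * area_int (\<lambda>z. disc_weight z * ((cmod (u z))\<^sup>2 * (a z)\<^sup>2))"
      unfolding U_def ring_distribs mult.left_commute[of _ "2::real"]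
      by (subst area_int_add, intro cc, intro cc)+ (simp add: area_int_cmul)
    also have "\<dots> \<le> (1 + 2 * \<alpha>) * circ_int (\<lambda>z. (cmod (u z))\<^sup>2)"
      using area_bound[OF u] area_deriv_bound[OF u] a[OF u] by (simp add: algebra_simps)
    finally show "area_int (\<lambda>z. disc_weight z * U z) \<le> (1 + 2 * \<alpha>) * circ_int (\<lambda>z. (cmod (u z))\<^sup>2)" .
    have n0: "0 \<le> circ_int (\<lambda>z. (cmod (\<psi> z))\<^sup>2)"
      using area_deriv_bound[OF \<psi>] area_int_nonneg[of "\<lambda>z. disc_weight z * (cmod (deriv \<psi> z))\<^sup>2"]
      by (force intro: cc simp: disc_weight_bounds)
    have "area_int (\<lambda>z. disc_weight z * V z) = 2 * area_int (\<lambda>z. disc_weight z * ((cmod (\<psi> z))\<^sup>2 * (a z)\<^sup>2))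
       + area_int (\<lambda>z. disc_weight z * (cmod (deriv \<psi> z))\<^sup>2) + area_int (\<lambda>z. disc_weight z * ((cmod (\<psi> z))\<^sup>2 * (b z)\<^sup>2))"
      unfolding V_def ring_distribs mult.left_commute[of _ "2::real"]
      by (subst area_int_add, intro cc, intro cc)+ (simp add: area_int_cmul)
    also have "\<dots> \<le> (1 + 2 * \<alpha> + \<beta>) * circ_int (\<lambda>z. (cmod (\<psi> z))\<^sup>2)"
      using area_deriv_bound[OF \<psi>] a[OF \<psi>] b[OF \<psi>] n0 by (simp add: algebra_simps)
    finally show "area_int (\<lambda>z. disc_weight z * V z) \<le> (1 + 2 * \<alpha> + \<beta>) * circ_int (\<lambda>z. (cmod (\<psi> z))\<^sup>2)" .
  qed (use t in auto)
  finally show ?thesis by (simp add: H_def)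
qed

text \<open>
  With \<open>P\<close> the Riesz projection, the boundary relation says \<open>v j = P (cnj (f j) * u)\<close>, so this is a
  lower bound for the adjoint of the row of multiplication operators on the Hardy space. Writing
  \<open>|u|\<^sup>2 = \<Sum> \<phi> j * u * (cnj (v j) + z * W j)\<close> with \<open>\<phi> j = cnj (f j) / \<Sum> |f k|\<^sup>2\<close>, only the term with
  \<open>W\<close> is not immediately bounded. Stokes' formula turns it into an area integral in which, since
  \<open>\<Sum> f j * \<phi> j = 1\<close>, the \<open>W j\<close> occur only through \<open>\<Psi> j k = f k * W j - f j * W k\<close>; on the circle
  \<open>u\<close> cancels in \<open>\<Psi>\<close>, which is therefore controlled by \<open>v\<close>.
\<close>

lemma corona_L2_estimate:
  fixes f v W :: "'i \<Rightarrow> complex \<Rightarrow> complex" and u :: "complex \<Rightarrow> complex"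
  assumes I: "finite I" "I \<noteq> {}" and d: "d > 0"
    and f: "\<And>j. j \<in> I \<Longrightarrow> f j holomorphic_on UNIV"
    and W: "\<And>j. j \<in> I \<Longrightarrow> W j holomorphic_on UNIV"
    and u: "u holomorphic_on UNIV"
    and cv: "\<And>j. j \<in> I \<Longrightarrow> continuous_on (sphere 0 1) (v j)"
    and f1: "\<And>j z. j \<in> I \<Longrightarrow> norm z \<le> 1 \<Longrightarrow> norm (f j z) \<le> 1"
    and lower: "\<And>z. norm z \<le> 1 \<Longrightarrow> d \<le> (\<Sum>j\<in>I. (cmod (f j z))\<^sup>2)"
    and bd: "\<And>j z. j \<in> I \<Longrightarrow> norm z = 1 \<Longrightarrow> f j z * cnj (u z) = cnj (v j z) + z * W j z"
    and N: "N = real (card I)" and e: "e = 1 / d\<^sup>2 + 2 / d ^ 3"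
    and a: "a = N / d + 17 * e * N\<^sup>2" and b: "b = 1 / d + 4 * N * e * (17 + 2 * N\<^sup>2)"
  shows "circ_int (\<lambda>z. (cmod (u z))\<^sup>2) \<le> 4 * a * b * (\<Sum>j\<in>I. circ_int (\<lambda>z. (cmod (v j z))\<^sup>2))"
proof -
  define \<rho> where "\<rho> z = (\<Sum>j\<in>I. f j z * cnj (f j z))" for z
  define \<rho>z where "\<rho>z z = (\<Sum>j\<in>I. deriv (f j) z * cnj (f j z))" for z
  define \<rho>b where "\<rho>b z = (\<Sum>j\<in>I. f j z * cnj (deriv (f j) z))" for z
  define \<Psi> where "\<Psi> j k z = f k z * W j z - f j z * W k z" for j k z
  define A where "A j k z = f k z * deriv (f j) z - f j z * deriv (f k) z" for j k z
  define n where "n g = circ_int (\<lambda>z. (cmod (g z))\<^sup>2)" for g :: "complex \<Rightarrow> complex"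
  have \<rho>_eq: "\<rho> z = of_real (\<Sum>j\<in>I. (cmod (f j z))\<^sup>2)" for z
    by (simp add: \<rho>_def complex_norm_square[symmetric])
  have \<rho>_norm: "d \<le> norm (\<rho> z)" if "norm z \<le> 1" for z
    unfolding \<rho>_eq norm_of_real using lower[OF that] by linarith
  have \<rho>0: "\<rho> z \<noteq> 0" if "norm z \<le> 1" for z
    using \<rho>_norm[OF that] d by auto
  have f': "deriv (f j) holomorphic_on UNIV" if "j \<in> I" for j
    using f[OF that] by (intro holomorphic_deriv) auto
  have hA: "A j k holomorphic_on UNIV" if "j \<in> I" "k \<in> I" for j k
    unfolding A_def by (intro holomorphic_intros f f' that)
  have h\<Psi>: "\<Psi> j k holomorphic_on UNIV" if "j \<in> I" "k \<in> I" for j k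
    unfolding \<Psi>_def by (intro holomorphic_intros f W that)
  have N1: "1 \<le> N" using I by (simp add: N Suc_leI card_gt_0_iff)
  have e0: "0 \<le> e" using d by (simp add: e)
  have cf: "continuous_on S (f j)" "continuous_on S (deriv (f j))" "continuous_on S (deriv (deriv (f j)))" if "j \<in> I" for S j
    using continuous_on_entire[OF f[OF that]] by auto
  have cW: "continuous_on S (W j)" "continuous_on S (deriv (W j))" if "j \<in> I" for S j
    using continuous_on_entire[OF W[OF that]] by auto
  note cu = continuous_on_entire[OF u]
  have c\<rho>: "continuous_on S \<rho>" "continuous_on S \<rho>z" "continuous_on S \<rho>b" for S
    unfolding \<rho>_def \<rho>z_def \<rho>b_def by (intro continuous_intros cf | assumption)+
  have c\<rho>i: "continuous_on S (\<lambda>z. inverse (\<rho> z))" if "S \<subseteq> cball 0 1" for S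
    by (intro continuous_on_inverse c\<rho>) (use that \<rho>0 in auto)
  have d\<rho>: "has_wirtinger \<rho> (\<rho>z z) (\<rho>b z) z" for z
    unfolding \<rho>_def
    by (rule has_wirtinger_eqI, (rule has_wirtinger_intros has_wirtinger_deriv[OF f] | assumption)+)
       (auto simp: \<rho>z_def \<rho>b_def)

  \<comment> \<open>The contribution of \<open>v\<close> to the norm of \<open>u\<close>\<close>
  define \<phi> where "\<phi> j z = cnj (f j z) * inverse (\<rho> z)" for j z
  have \<phi>_bound: "norm (\<phi> j z) \<le> 1 / d" if "j \<in> I" "norm z \<le> 1" for j z
  proof -
    have "norm (\<phi> j z) \<le> 1 * inverse (norm (\<rho> z))"
      unfolding \<phi>_def norm_mult norm_inverse using f1[OF that] by (intro mult_right_mono) auto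
    also have "\<dots> \<le> inverse d" using \<rho>_norm[OF that(2)] d by (simp add: le_imp_inverse_le)
    finally show ?thesis by (simp add: divide_inverse)
  qed
  have c\<phi>: "continuous_on S (\<phi> j)" if "S \<subseteq> cball 0 1" "j \<in> I" for S j
    unfolding \<phi>_def by (intro continuous_intros cf c\<rho>i that)
  have first: "norm (circ_int (\<lambda>z. \<Sum>j\<in>I. \<phi> j z * (u z * cnj (v j z)))) \<le> t * (N / d * n u) + (1/t) * (1 / d * (\<Sum>j\<in>I. n (v j)))" if t: "t > 0" for t
  proof -
    have "norm (circ_int (\<lambda>z. \<Sum>j\<in>I. \<phi> j z * (u z * cnj (v j z)))) \<le>
       circ_int (\<lambda>z. \<Sum>j\<in>I. ((t/d) * (cmod (u z))\<^sup>2 + (1 / (t*d)) * (cmod (v j z))\<^sup>2))"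
    proof (intro circ_int_norm_le continuous_intros c\<phi> cu cv)
      fix z :: complex assume z: "norm z = 1"
      show "norm (\<Sum>j\<in>I. \<phi> j z * (u z * cnj (v j z))) \<le> (\<Sum>j\<in>I. ((t/d) * (cmod (u z))\<^sup>2 + (1 / (t*d)) * (cmod (v j z))\<^sup>2))"
      proof (intro sum_norm_le)
        fix j assume j: "j \<in> I"
        have "norm (\<phi> j z * (u z * cnj (v j z))) \<le> (1/d) * (cmod (u z) * cmod (v j z))"
          unfolding norm_mult complex_mod_cnj using z \<phi>_bound[OF j] by (intro mult_right_mono) auto
        also have "\<dots> \<le> (1/d) * (t * (cmod (u z))\<^sup>2 + (cmod (v j z))\<^sup>2 / t)"
          using d t by (intro mult_left_mono am_gm_weighted) auto
        finally show "norm (\<phi> j z * (u z * cnj (v j z))) \<le> (t/d) * (cmod (u z))\<^sup>2 + (1 / (t*d)) * (cmod (v j z))\<^sup>2"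
          using d t by (simp add: field_simps)
      qed
    qed auto
    also have "\<dots> = (\<Sum>j\<in>I. (t/d) * n u + (1 / (t*d)) * n (v j))"
      unfolding n_def circ_int_cmul[symmetric]
      by (subst circ_int_sum, rule I, intro continuous_intros cu cv, assumption, intro sum.cong refl circ_int_add continuous_intros cu cv)
    also have "\<dots> = t * (N / d * n u) + (1/t) * (1 / d * (\<Sum>j\<in>I. n (v j)))"
      by (simp add: sum.distrib N sum_distrib_left sum_divide_distrib)
    finally show ?thesis .
  qed

  \<comment> \<open>The contribution of \<open>W\<close>, rewritten as an area integral\<close>
  define Q where "Q z = (\<Sum>j\<in>I. u z * W j z * \<phi> j z)" for z
  \<comment> \<open>This is the Koszul expression \<phi>_k dbar \<phi>_j - \<phi>_j dbar \<phi>_k.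
    The numerator \<open>A j k\<close> is holomorphic, so conjugating it leaves only the powers of
    1/\<rho> to contribute to \<open>Gz\<close>.\<close>
  define G where "G j k z = cnj (A j k z) * (inverse (\<rho> z) * inverse (\<rho> z))" for j k z
  define Gz where "Gz j k z = cnj (A j k z) * (-2 * \<rho>z z * inverse (\<rho> z) ^ 3)" for j k z
  define Gb where "Gb j k z = cnj (deriv (A j k) z) * (inverse (\<rho> z) * inverse (\<rho> z)) + cnj (A j k z) * (-2 * \<rho>b z * inverse (\<rho> z) ^ 3)" for j k z
  have cG: "continuous_on (cball 0 1) (G j k)" "continuous_on (cball 0 1) (Gz j k)" "continuous_on (cball 0 1) (Gb j k)"
    if "j \<in> I" "k \<in> I" for j k
    unfolding G_def Gz_def Gb_def by (intro continuous_intros c\<rho> c\<rho>i continuous_on_entire[OF hA] that order.refl)+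
  have dG: "has_wirtinger (G j k) (Gz j k z) (Gb j k z) z" if "j \<in> I" "k \<in> I" "norm z \<le> 1" for j k z
    unfolding G_def
    by (rule has_wirtinger_eqI, (rule has_wirtinger_intros has_wirtinger_deriv[OF hA] d\<rho> \<rho>0 that)+)
       (use \<rho>0[OF that(3)] in \<open>auto simp: Gz_def Gb_def divide_simps power2_eq_square power3_eq_cube\<close>)
  \<comment> \<open>Since u W_j is holomorphic, dbar falls on \<phi>_j alone, and dbar \<phi>_j =
    sum_k f_k G_jk because sum_k f_k \<phi>_k = 1. As \<open>G\<close> is antisymmetric in its
    indices, f_k W_j may be replaced by half of \<open>\<Psi> j k\<close>; this 1/2 cancels the 2 in
    Stokes' formula.\<close>
  have Qb: "has_wirtinger Q (\<Sum>j\<in>I. (deriv u z * W j z + u z * deriv (W j) z) * \<phi> j z - u z * W j z * cnj (f j z) * (\<rho>z z * (inverse (\<rho> z))\<^sup>2))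
      ((1/2) * (\<Sum>j\<in>I. \<Sum>k\<in>I. u z * \<Psi> j k z * G j k z)) z" if z: "norm z \<le> 1" for z
  proof -
    have "has_wirtinger Q (\<Sum>j\<in>I. (deriv u z * W j z + u z * deriv (W j) z) * \<phi> j z - u z * W j z * cnj (f j z) * (\<rho>z z * (inverse (\<rho> z))\<^sup>2))
      (\<Sum>j\<in>I. u z * W j z * (cnj (deriv (f j) z) * inverse (\<rho> z) - cnj (f j z) * (\<rho>b z * (inverse (\<rho> z))\<^sup>2))) z"
      unfolding Q_def \<phi>_def
      by (rule has_wirtinger_eqI, (rule has_wirtinger_intros has_wirtinger_deriv[OF f] has_wirtinger_deriv[OF W] has_wirtinger_deriv[OF u] d\<rho> \<rho>0 z | assumption)+)
         (auto intro!: sum.cong simp: divide_inverse power2_eq_square algebra_simps)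
    moreover have "(\<Sum>j\<in>I. u z * W j z * (cnj (deriv (f j) z) * inverse (\<rho> z) - cnj (f j z) * (\<rho>b z * (inverse (\<rho> z))\<^sup>2)))
       = (1/2) * (\<Sum>j\<in>I. \<Sum>k\<in>I. u z * \<Psi> j k z * G j k z)"
    proof -
      let ?r = "inverse (\<rho> z) * inverse (\<rho> z)"
      have "cnj (deriv (f j) z) * inverse (\<rho> z) - cnj (f j z) * (\<rho>b z * (inverse (\<rho> z))\<^sup>2) = (\<Sum>k\<in>I. f k z * G j k z)" for j
      proof -
        have "(\<Sum>k\<in>I. f k z * G j k z) = (\<Sum>k\<in>I. (f k z * cnj (f k z)) * (cnj (deriv (f j) z) * ?r) - (f k z * cnj (deriv (f k) z)) * (cnj (f j z) * ?r))"
          by (simp add: G_def A_def algebra_simps)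
        also have "\<dots> = \<rho> z * (cnj (deriv (f j) z) * ?r) - \<rho>b z * (cnj (f j z) * ?r)"
          by (simp add: sum_subtractf \<rho>_def \<rho>b_def sum_distrib_right)
        finally show ?thesis using \<rho>0[OF z] by (simp add: power2_eq_square mult_ac)
      qed
      then have E: "(\<Sum>j\<in>I. u z * W j z * (cnj (deriv (f j) z) * inverse (\<rho> z) - cnj (f j z) * (\<rho>b z * (inverse (\<rho> z))\<^sup>2)))
         = (\<Sum>j\<in>I. \<Sum>k\<in>I. u z * (f k z * W j z) * G j k z)" (is "?L = _")
        by (simp add: sum_distrib_left mult_ac)
      \<comment> \<open>Exchanging the names of the two indices costs a sign, by the antisymmetry of
        \<open>A\<close>; this yields the second half of \<open>\<Psi>\<close>.\<close>
      also have "\<dots> = (\<Sum>k\<in>I. \<Sum>j\<in>I. u z * (f k z * W j z) * G j k z)" by (rule sum.swap)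
      also have "\<dots> = - (\<Sum>j\<in>I. \<Sum>k\<in>I. u z * (f j z * W k z) * G j k z)"
        by (simp add: sum_negf[symmetric] G_def A_def algebra_simps)
      finally have E2: "?L = - (\<Sum>j\<in>I. \<Sum>k\<in>I. u z * (f j z * W k z) * G j k z)" .
      have "(\<Sum>j\<in>I. \<Sum>k\<in>I. u z * \<Psi> j k z * G j k z) = (\<Sum>j\<in>I. \<Sum>k\<in>I. u z * (f k z * W j z) * G j k z) - (\<Sum>j\<in>I. \<Sum>k\<in>I. u z * (f j z * W k z) * G j k z)"
        by (simp add: \<Psi>_def algebra_simps sum_subtractf)
      also have "\<dots> = 2 * ?L" using E E2 by simp
      finally show ?thesis by simp
    qed
    ultimately show ?thesis by simp
  qed
  have circ_Q: "circ_int (\<lambda>z. z * Q z) = (\<Sum>j\<in>I. \<Sum>k\<in>I. area_int (\<lambda>z. u z * \<Psi> j k z * G j k z))"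
  proof -
    have "circ_int (\<lambda>z. z * Q z) = area_int (\<lambda>z. 2 * ((1/2) * (\<Sum>j\<in>I. \<Sum>k\<in>I. u z * \<Psi> j k z * G j k z)))"
      by (rule stokes_disc[OF Qb[unfolded has_wirtinger_def]])
         (intro continuous_intros cu cW cf c\<phi> c\<rho> c\<rho>i cG continuous_on_entire[OF h\<Psi>] order.refl | assumption)+
    also have "\<dots> = (\<Sum>j\<in>I. \<Sum>k\<in>I. area_int (\<lambda>z. u z * \<Psi> j k z * G j k z))"
      by (simp, subst area_int_sum, rule I, (intro continuous_intros cu cG continuous_on_entire[OF h\<Psi>] | assumption)+,
          intro sum.cong refl area_int_sum I, (intro continuous_intros cu cG continuous_on_entire[OF h\<Psi>] | assumption)+)
    finally show ?thesis .
  qed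

  \<comment> \<open>Carleson bounds and the estimate of the area integrals\<close>
  have alpha: "area_int (\<lambda>z. disc_weight z * ((cmod (g z))\<^sup>2 * (cmod (A j k z))\<^sup>2)) \<le> 8 * n g"
    if g: "g holomorphic_on UNIV" and jk: "j \<in> I" "k \<in> I" for g j k
  proof -
    note cc = continuous_intros continuous_on_entire[OF g] cf[OF jk(1)] cf[OF jk(2)] continuous_on_entire[OF hA[OF jk]]
    let ?D = "\<lambda>j z. disc_weight z * ((cmod (g z))\<^sup>2 * (cmod (deriv (f j) z))\<^sup>2)"
    have "area_int (\<lambda>z. disc_weight z * ((cmod (g z))\<^sup>2 * (cmod (A j k z))\<^sup>2)) \<le> area_int (\<lambda>z. 2 * ?D j z + 2 * ?D k z)"
    proof (intro area_int_mono cc)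
      fix z :: complex assume z: "norm z \<le> 1"
      have "cmod (A j k z) \<le> cmod (f k z) * cmod (deriv (f j) z) + cmod (f j z) * cmod (deriv (f k) z)"
        unfolding A_def norm_mult[symmetric] by (rule norm_triangle_ineq4)
      also have "\<dots> \<le> cmod (deriv (f j) z) + cmod (deriv (f k) z)"
        using f1[OF jk(1) z] f1[OF jk(2) z] by (intro add_mono mult_left_le_one_le) auto
      finally have "(cmod (A j k z))\<^sup>2 \<le> (cmod (deriv (f j) z) + cmod (deriv (f k) z))\<^sup>2" by (intro power_mono) auto
      also have "\<dots> \<le> 2 * (cmod (deriv (f j) z))\<^sup>2 + 2 * (cmod (deriv (f k) z))\<^sup>2"
        using sum_squares_bound[of "cmod (deriv (f j) z)" "cmod (deriv (f k) z)"] by (simp add: power2_sum)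
      finally have "disc_weight z * (cmod (g z))\<^sup>2 * (cmod (A j k z))\<^sup>2 \<le> disc_weight z * (cmod (g z))\<^sup>2 * (2 * (cmod (deriv (f j) z))\<^sup>2 + 2 * (cmod (deriv (f k) z))\<^sup>2)"
        using disc_weight_bounds[OF z] by (intro mult_left_mono) auto
      then show "disc_weight z * ((cmod (g z))\<^sup>2 * (cmod (A j k z))\<^sup>2) \<le> 2 * ?D j z + 2 * ?D k z" by (simp add: algebra_simps)
    qed
    also have "\<dots> = 2 * area_int (?D j) + 2 * area_int (?D k)"
      unfolding area_int_cmul[symmetric] by (intro area_int_add cc)
    also have "\<dots> \<le> 8 * n g"
      using carleson_bound[OF f[OF jk(1)] g f1[OF jk(1)]] carleson_bound[OF f[OF jk(2)] g f1[OF jk(2)]] by (simp add: n_def)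
    finally show ?thesis .
  qed
  have beta: "area_int (\<lambda>z. disc_weight z * ((cmod (g z))\<^sup>2 * (cmod (\<rho>z z))\<^sup>2)) \<le> 2 * N\<^sup>2 * n g"
    if g: "g holomorphic_on UNIV" for g
  proof -
    note cc = continuous_intros continuous_on_entire[OF g] cf c\<rho>
    let ?D = "\<lambda>j z. disc_weight z * ((cmod (g z))\<^sup>2 * (cmod (deriv (f j) z))\<^sup>2)"
    have "area_int (\<lambda>z. disc_weight z * ((cmod (g z))\<^sup>2 * (cmod (\<rho>z z))\<^sup>2)) \<le> area_int (\<lambda>z. \<Sum>j\<in>I. N * ?D j z)"
    proof (intro area_int_mono cc)
      fix z :: complex assume z: "norm z \<le> 1"
      have "cmod (\<rho>z z) \<le> (\<Sum>j\<in>I. cmod (deriv (f j) z) * cmod (cnj (f j z)))"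
        unfolding \<rho>z_def norm_mult[symmetric] by (rule norm_sum)
      also have "\<dots> \<le> (\<Sum>j\<in>I. cmod (deriv (f j) z))"
        using f1[OF _ z] by (intro sum_mono mult_right_le_one_le) auto
      finally have "(cmod (\<rho>z z))\<^sup>2 \<le> (\<Sum>j\<in>I. cmod (deriv (f j) z))\<^sup>2" by (intro power_mono) auto
      also have "\<dots> \<le> (\<Sum>j\<in>I. N * (cmod (deriv (f j) z))\<^sup>2)"
        using sum_squared_le_sum_of_squares[of "\<lambda>j. cmod (deriv (f j) z)" I]
        by (simp add: N sum_distrib_left sum_distrib_right mult_ac)
      finally have "disc_weight z * (cmod (g z))\<^sup>2 * (cmod (\<rho>z z))\<^sup>2 \<le> disc_weight z * (cmod (g z))\<^sup>2 * (\<Sum>j\<in>I. N * (cmod (deriv (f j) z))\<^sup>2)"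
        using disc_weight_bounds[OF z] by (intro mult_left_mono) auto
      then show "disc_weight z * ((cmod (g z))\<^sup>2 * (cmod (\<rho>z z))\<^sup>2) \<le> (\<Sum>j\<in>I. N * ?D j z)"
        by (simp add: sum_distrib_left mult_ac)
    qed auto
    also have "\<dots> = (\<Sum>j\<in>I. N * area_int (?D j))"
      unfolding area_int_cmul[symmetric] by (intro area_int_sum cc I)
    also have "\<dots> \<le> (\<Sum>j\<in>I. N * (2 * n g))"
      using carleson_bound[OF f g f1] N1 by (intro sum_mono mult_left_mono) (auto simp: n_def)
    also have "\<dots> = 2 * N\<^sup>2 * n g" by (simp add: N power2_eq_square)
    finally show ?thesis .
  qed
  \<comment> \<open>Here 17 is 1 + 2 * 8 with the 8 of \<open>alpha\<close>, and
    \<open>2 * N\<^sup>2\<close> comes from \<open>beta\<close>. In \<open>e\<close> the summand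
    \<open>1 / d\<^sup>2\<close> bounds \<open>G\<close> and \<open>2 / d ^ 3\<close> bounds
    \<open>Gz\<close>; their sum serves for both.\<close>
  have pair_term: "norm (area_int (\<lambda>z. u z * \<Psi> j k z * G j k z)) \<le> e * (t * (17 * n u) + ((17 + 2 * N\<^sup>2) * n (\<Psi> j k)) / t)"
    if t: "t > 0" and jk: "j \<in> I" "k \<in> I" for t j k
  proof -
    have "norm (area_int (\<lambda>z. u z * \<Psi> j k z * G j k z)) \<le>
      e * (t * ((1 + 2 * 8) * circ_int (\<lambda>z. (cmod (u z))\<^sup>2)) + ((1 + 2 * 8 + 2 * N\<^sup>2) * circ_int (\<lambda>z. (cmod (\<Psi> j k z))\<^sup>2)) / t)"
    proof (rule area_bilinear_bound[OF u h\<Psi>[OF jk] dG[OF jk] cG(2,3)[OF jk], where a="\<lambda>z. cmod (A j k z)" and b="\<lambda>z. cmod (\<rho>z z)"])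
      fix z :: complex assume z: "norm z \<le> 1"
      have r: "inverse (norm (\<rho> z)) \<le> inverse d" "0 \<le> inverse (norm (\<rho> z))" using \<rho>_norm[OF z] d by (auto simp: le_imp_inverse_le)
      have r2: "inverse (norm (\<rho> z)) ^ m \<le> inverse d ^ m" for m by (rule power_mono[OF r])
      have "norm (G j k z) = inverse (norm (\<rho> z)) ^ 2 * norm (A j k z)"
        by (simp add: G_def norm_mult norm_inverse power2_eq_square)
      also have "\<dots> \<le> inverse d ^ 2 * norm (A j k z)" by (intro mult_right_mono r2) auto
      also have "\<dots> \<le> e * norm (A j k z)" using d by (intro mult_right_mono) (auto simp: e power_inverse divide_inverse)
      finally show "norm (G j k z) \<le> e * norm (A j k z)" .
      have "norm (Gz j k z) = 2 * inverse (norm (\<rho> z)) ^ 3 * (norm (A j k z) * norm (\<rho>z z))"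
        by (simp add: Gz_def norm_mult norm_inverse norm_power)
      also have "\<dots> \<le> 2 * inverse d ^ 3 * (norm (A j k z) * norm (\<rho>z z))" by (intro mult_right_mono mult_left_mono r2) auto
      also have "\<dots> \<le> e * (norm (A j k z) * norm (\<rho>z z))" using d by (intro mult_right_mono) (auto simp: e power_inverse divide_inverse)
      finally show "norm (Gz j k z) \<le> e * (norm (A j k z) * norm (\<rho>z z))" .
    qed (use alpha[OF _ jk] beta t e0 in \<open>auto simp: n_def intro!: continuous_intros c\<rho> continuous_on_entire[OF hA[OF jk]]\<close>)
    then show ?thesis by (simp add: n_def)
  qed
  have n\<Psi>: "n (\<Psi> j k) \<le> 2 * n (v j) + 2 * n (v k)" if jk: "j \<in> I" "k \<in> I" for j k
  proof -
    have "n (\<Psi> j k) \<le> circ_int (\<lambda>z. 2 * (cmod (v j z))\<^sup>2 + 2 * (cmod (v k z))\<^sup>2)"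
      unfolding n_def
    proof (intro circ_int_mono continuous_intros cv jk continuous_on_entire[OF h\<Psi>])
      fix z :: complex assume z: "norm z = 1"
      have "z * \<Psi> j k z = f k z * (z * W j z) - f j z * (z * W k z)" by (simp add: \<Psi>_def algebra_simps)
      also have "z * W j z = f j z * cnj (u z) - cnj (v j z)" using bd[OF jk(1) z] by simp
      also have "z * W k z = f k z * cnj (u z) - cnj (v k z)" using bd[OF jk(2) z] by simp
      finally have "z * \<Psi> j k z = f j z * cnj (v k z) - f k z * cnj (v j z)" by (simp add: algebra_simps)
      then have "cmod (\<Psi> j k z) = cmod (f j z * cnj (v k z) - f k z * cnj (v j z))" using z by (metis norm_mult mult_1)
      also have "\<dots> \<le> cmod (f j z) * cmod (v k z) + cmod (f k z) * cmod (v j z)"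
        using norm_triangle_ineq4[of "f j z * cnj (v k z)" "f k z * cnj (v j z)"] by (simp add: norm_mult)
      also have "\<dots> \<le> cmod (v k z) + cmod (v j z)"
        using f1[OF jk(1), of z] f1[OF jk(2), of z] z by (intro add_mono mult_left_le_one_le) auto
      finally have "(cmod (\<Psi> j k z))\<^sup>2 \<le> (cmod (v k z) + cmod (v j z))\<^sup>2" by (intro power_mono) auto
      also have "\<dots> \<le> 2 * (cmod (v j z))\<^sup>2 + 2 * (cmod (v k z))\<^sup>2"
        using sum_squares_bound[of "cmod (v k z)" "cmod (v j z)"] by (simp add: power2_sum)
      finally show "(cmod (\<Psi> j k z))\<^sup>2 \<le> 2 * (cmod (v j z))\<^sup>2 + 2 * (cmod (v k z))\<^sup>2" .
    qed
    also have "\<dots> = 2 * n (v j) + 2 * n (v k)"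
      unfolding n_def circ_int_cmul[symmetric] by (intro circ_int_add continuous_intros cv jk)
    finally show ?thesis .
  qed

  \<comment> \<open>Summation and absorption of the norm of \<open>u\<close>\<close>
  define S where "S = (\<Sum>j\<in>I. n (v j))"
  have pair_sum: "(\<Sum>j\<in>I. \<Sum>k\<in>I. e * (t * (17 * n u) + ((17 + 2 * N\<^sup>2) * (2 * n (v j) + 2 * n (v k))) / t))
      = t * (17 * e * N\<^sup>2 * n u) + (1/t) * (4 * N * e * (17 + 2 * N\<^sup>2) * S)" for t
  proof -
    have "(\<Sum>j\<in>I. \<Sum>k\<in>I. p + q * x j + q * x k) = N\<^sup>2 * p + 2 * N * q * (\<Sum>j\<in>I. x j)" for p q :: real and x
      by (simp add: sum.distrib sum_distrib_left[symmetric] N power2_eq_square ring_distribs)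
    note sums = this[of "e * t * 17 * n u" "2 * e * M / t" "\<lambda>j. n (v j)" for M]
    have split: "e * (t * (17 * n u) + (M * (2 * x + 2 * y)) / t) = e * t * 17 * n u + 2 * e * M / t * x + 2 * e * M / t * y" for M x y
      by (cases "t = 0") (auto simp: field_simps)
    show ?thesis
      unfolding split sums by (simp add: S_def)
  qed
  \<comment> \<open>In both \<open>a\<close> and \<open>b\<close> the first summand comes from
    \<open>first\<close> and the second from the area integrals: \<open>a\<close> multiplies
    \<open>t\<close> and the norm of \<open>u\<close>, \<open>b\<close> multiplies 1/t and the norms
    of the \<open>v j\<close>.\<close>
  have main: "n u \<le> t * (a * n u) + (1/t) * (b * S)" if t: "t > 0" for t
  proof -
    have "complex_of_real (n u) = circ_int (\<lambda>z. complex_of_real ((cmod (u z))\<^sup>2))"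
      unfolding n_def by (intro circ_int_of_real[symmetric] continuous_intros cu)
    also have "\<dots> = circ_int (\<lambda>z. (\<Sum>j\<in>I. \<phi> j z * (u z * cnj (v j z))) + z * Q z)"
    proof (rule circ_int_cong)
      fix z :: complex assume z: "norm z = 1"
      have "(\<Sum>j\<in>I. \<phi> j z * (u z * cnj (v j z))) + z * Q z = (\<Sum>j\<in>I. \<phi> j z * u z * (cnj (v j z) + z * W j z))"
        by (simp add: Q_def sum_distrib_left sum.distrib[symmetric] algebra_simps)
      also have "\<dots> = (\<Sum>j\<in>I. \<phi> j z * u z * (f j z * cnj (u z)))" using bd[OF _ z] by simp
      also have "\<dots> = (\<Sum>j\<in>I. (u z * cnj (u z) * inverse (\<rho> z)) * (f j z * cnj (f j z)))"
        unfolding \<phi>_def by (intro sum.cong refl) (simp only: mult_ac)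
      also have "\<dots> = (u z * cnj (u z) * inverse (\<rho> z)) * \<rho> z"
        unfolding \<rho>_def[of z] by (rule sum_distrib_left[symmetric])
      also have "\<dots> = complex_of_real ((cmod (u z))\<^sup>2)" using \<rho>0[of z] z by (simp add: complex_norm_square[symmetric])
      finally show "complex_of_real ((cmod (u z))\<^sup>2) = (\<Sum>j\<in>I. \<phi> j z * (u z * cnj (v j z))) + z * Q z" by simp
    qed
    also have "\<dots> = circ_int (\<lambda>z. \<Sum>j\<in>I. \<phi> j z * (u z * cnj (v j z))) + circ_int (\<lambda>z. z * Q z)"
      unfolding Q_def by (rule circ_int_add; intro continuous_intros cu c\<phi> cv cW) auto
    finally have split: "complex_of_real (n u) = circ_int (\<lambda>z. \<Sum>j\<in>I. \<phi> j z * (u z * cnj (v j z))) + circ_int (\<lambda>z. z * Q z)" .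
    have "norm (complex_of_real (n u)) \<le> norm (circ_int (\<lambda>z. \<Sum>j\<in>I. \<phi> j z * (u z * cnj (v j z)))) + norm (circ_int (\<lambda>z. z * Q z))"
      unfolding split by (rule norm_triangle_ineq)
    also have "norm (circ_int (\<lambda>z. z * Q z)) \<le> (\<Sum>j\<in>I. \<Sum>k\<in>I. e * (t * (17 * n u) + ((17 + 2 * N\<^sup>2) * (2 * n (v j) + 2 * n (v k))) / t))"
      unfolding circ_Q
    proof (intro sum_norm_le)
      fix j k assume jk: "j \<in> I" "k \<in> I"
      have "norm (area_int (\<lambda>z. u z * \<Psi> j k z * G j k z)) \<le> e * (t * (17 * n u) + ((17 + 2 * N\<^sup>2) * n (\<Psi> j k)) / t)"
        by (rule pair_term[OF t jk])
      also have "\<dots> \<le> e * (t * (17 * n u) + ((17 + 2 * N\<^sup>2) * (2 * n (v j) + 2 * n (v k))) / t)"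
        using t n\<Psi>[OF jk] by (intro mult_left_mono add_mono divide_right_mono e0) auto
      finally show "norm (area_int (\<lambda>z. u z * \<Psi> j k z * G j k z)) \<le> \<dots>" .
    qed
    also have "\<dots> = t * (17 * e * N\<^sup>2 * n u) + (1/t) * (4 * N * e * (17 + 2 * N\<^sup>2) * S)"
      by (rule pair_sum)
    finally have "n u \<le> norm (circ_int (\<lambda>z. \<Sum>j\<in>I. \<phi> j z * (u z * cnj (v j z)))) + (t * (17 * e * N\<^sup>2 * n u) + (1/t) * (4 * N * e * (17 + 2 * N\<^sup>2) * S))"
      unfolding norm_of_real by linarith
    also have "\<dots> \<le> (t * (N / d * n u) + (1/t) * (1 / d * S)) + (t * (17 * e * N\<^sup>2 * n u) + (1/t) * (4 * N * e * (17 + 2 * N\<^sup>2) * S))"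
      using first[OF t] by (simp add: S_def)
    also have "\<dots> = t * (a * n u) + (1/t) * (b * S)"
      unfolding a b by (simp only: ring_distribs add_ac)
    finally show ?thesis .
  qed
  have a0: "a > 0" unfolding a using d N1 e0 by (intro add_pos_nonneg) auto
  \<comment> \<open>The choice t = 1 / (2a) makes the \<open>u\<close> term half of the left side;
    absorbing it turns 2ab into 4ab.\<close>
  have "n u \<le> 1 / (2*a) * (a * n u) + 1 / (1 / (2*a)) * (b * S)" using a0 by (intro main) auto
  also have "\<dots> = n u / 2 + 2 * a * b * S" using a0 by simp
  finally show ?thesis by (simp add: n_def S_def)
qed

section \<open>From operator lower bounds to bounded analytic solutions\<close>

lemma orthonormal_poly_basis:
  fixes Q :: "complex poly \<Rightarrow> complex poly \<Rightarrow> complex"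
  assumes add: "\<And>p q r. Q (p + q) r = Q p r + Q q r"
    and smult: "\<And>a p r. Q (smult a p) r = a * Q p r"
    and herm: "\<And>p q. Q q p = cnj (Q p q)"
    and pos: "\<And>p. p \<noteq> 0 \<Longrightarrow> (\<forall>k\<ge>m. coeff p k = 0) \<Longrightarrow> 0 < Re (Q p p)"
  shows "\<exists>xs. (\<forall>i<m. \<forall>k\<ge>m. coeff (xs i) k = 0) \<and> (\<forall>i<m. \<forall>j<m. Q (xs i) (xs j) = of_bool (i = j)) \<and>
    (\<forall>p. (\<forall>k\<ge>m. coeff p k = 0) \<longrightarrow> p = (\<Sum>i<m. smult (Q p (xs i)) (xs i)))"
  using pos
proof (induction m)
  case 0
  then show ?case by (auto simp: poly_eq_iff)
next
  case (Suc m)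
  have Q0: "Q 0 r = 0" for r using smult[of 0 0 r] by simp
  have diff: "Q (p - q) r = Q p r - Q q r" for p q r
    using add[of p "smult (-1) q" r] smult[of "-1" q r] by simp
  have sum: "Q (\<Sum>i\<in>A. h i) r = (\<Sum>i\<in>A. Q (h i) r)" for A :: "nat set" and h r
    by (induction A rule: infinite_finite_induct) (auto simp: Q0 add)
  have smult2: "Q p (smult a q) = cnj a * Q p q" for a p q
    by (metis herm smult complex_cnj_mult)
  have "\<exists>xs. (\<forall>i<m. \<forall>k\<ge>m. coeff (xs i) k = 0) \<and> (\<forall>i<m. \<forall>j<m. Q (xs i) (xs j) = of_bool (i = j)) \<and>
    (\<forall>p. (\<forall>k\<ge>m. coeff p k = 0) \<longrightarrow> p = (\<Sum>i<m. smult (Q p (xs i)) (xs i)))"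
    by (rule Suc.IH) (use Suc.prems in auto)
  then obtain xs where xs: "\<forall>i<m. \<forall>k\<ge>m. coeff (xs i) k = 0" "\<forall>i<m. \<forall>j<m. Q (xs i) (xs j) = of_bool (i = j)"
    "\<forall>p. (\<forall>k\<ge>m. coeff p k = 0) \<longrightarrow> p = (\<Sum>i<m. smult (Q p (xs i)) (xs i))"
    by (elim exE conjE)
  note X = xs(1)[rule_format] and on = xs(2)[rule_format] and rep = xs(3)[rule_format]
  \<comment> \<open>Subtracting the projection of the new monomial onto lower degrees keeps the
    leading coefficient 1, so \<open>y\<close> is nonzero and can be normalised.\<close>
  define y where "y = monom 1 m - (\<Sum>i<m. smult (Q (monom 1 m) (xs i)) (xs i))"
  have ym: "coeff y m = 1" by (simp add: y_def coeff_sum X)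
  have yX: "coeff y k = 0" if "k \<ge> Suc m" for k using that by (simp add: y_def coeff_sum X)
  have yx: "Q y (xs j) = 0" if "j < m" for j
    using that by (simp add: y_def diff sum smult on of_bool_def if_distrib[of "\<lambda>x. _ * x"] cong: if_cong)
  have xy: "Q (xs j) y = 0" if "j < m" for j using yx[OF that] herm by (metis complex_cnj_zero)
  have "y \<noteq> 0" using ym by auto
  then have s0: "0 < Re (Q y y)" using Suc.prems yX by blast
  define s where "s = sqrt (Re (Q y y))"
  have s: "s > 0" "s * s = Re (Q y y)" using s0 by (auto simp: s_def)
  have "Im (Q y y) = Im (cnj (Q y y))" by (rule arg_cong[OF herm])
  then have Qy: "Q y y = of_real s * of_real s"
    using s(2) by (simp add: complex_eq_iff)
  define xm where "xm = smult (1 / of_real s) y"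
  have Qm: "Q p xm = Q p y / of_real s" for p by (simp add: xm_def smult2)
  have Qm': "Q xm p = Q y p / of_real s" for p by (simp add: xm_def smult)
  show ?case
  proof (intro exI[of _ "xs(m := xm)"] conjI allI impI)
    fix i k assume "i < Suc m" "Suc m \<le> k"
    then show "coeff ((xs(m := xm)) i) k = 0" using X yX by (auto simp: xm_def)
  next
    fix i j assume "i < Suc m" "j < Suc m"
    then show "Q ((xs(m := xm)) i) ((xs(m := xm)) j) = of_bool (i = j)"
      using on xy yx s by (auto simp: Qm Qm' Qy less_Suc_eq)
  next
    fix p :: "complex poly" assume p: "\<forall>k\<ge>Suc m. coeff p k = 0"
    define \<alpha> where "\<alpha> = coeff p m"
    \<comment> \<open>Removing the multiple of \<open>y\<close> with the same top coefficient leaves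
      a polynomial to which the inductive expansion applies.\<close>
    define x where "x = p - smult \<alpha> y"
    have "\<forall>k\<ge>m. coeff x k = 0"
    proof (intro allI impI)
      fix k assume "m \<le> k"
      then show "coeff x k = 0" using p yX ym by (cases "k = m") (auto simp: x_def \<alpha>_def)
    qed
    note repx = xs(3)[rule_format, OF this[rule_format]]
    have px: "Q p r = Q x r + \<alpha> * Q y r" for r by (simp add: x_def diff smult)
    have "Q x y = Q (\<Sum>i<m. smult (Q x (xs i)) (xs i)) y" using repx by simp
    also have "\<dots> = 0" by (simp add: sum smult xy)
    finally have "Q p xm = \<alpha> * of_real s" using s by (simp add: px Qm Qy)
    then have "smult (Q p xm) xm = smult \<alpha> y" using s by (simp add: xm_def)
    moreover have "(\<Sum>i<m. smult (Q p (xs i)) (xs i)) = x"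
      using repx yx by (simp add: px)
    moreover have "(\<Sum>i<Suc m. smult (Q p ((xs(m := xm)) i)) ((xs(m := xm)) i)) = (\<Sum>i<m. smult (Q p (xs i)) (xs i)) + smult (Q p xm) xm"
      by simp
    ultimately show "p = (\<Sum>i<Suc m. smult (Q p ((xs(m := xm)) i)) ((xs(m := xm)) i))"
      by (simp add: x_def)
  qed
qed

lemma smult_sum_right: "smult c (\<Sum>i\<in>A. f i) = (\<Sum>i\<in>A. smult c (f i))"
  by (induction A rule: infinite_finite_induct) (auto simp: smult_add_right)

text \<open>\<open>k\<close> is the energy stored in a dissipative linear system driven by a unit input, and \<open>s\<close> its output power.\<close>

lemma storage_limit_le_one:
  fixes k s :: "nat \<Rightarrow> real"
  assumes k0: "\<And>t. 0 \<le> k t" and step: "\<And>t. k (Suc t) + s (Suc t) \<le> k t + 1"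
    and lim: "s \<longlonglongrightarrow> \<sigma>"
  shows "\<sigma> \<le> 1"
proof (rule ccontr)
  assume "\<not> \<sigma> \<le> 1"
  define \<eta> where "\<eta> = (\<sigma> - 1) / 2"
  have \<eta>: "\<eta> > 0" "1 + \<eta> < \<sigma>" using \<open>\<not> \<sigma> \<le> 1\<close> by (auto simp: \<eta>_def field_simps)
  then obtain T where T: "\<And>t. t \<ge> T \<Longrightarrow> 1 + \<eta> < s t"
    using order_tendstoD(1)[OF lim \<eta>(2)] by (auto simp: eventually_sequentially)
  \<comment> \<open>Once the output exceeds 1 + \<eta> while the input is 1, each step drains at
    least \<eta> from the storage, which cannot go on since the storage is nonnegative.\<close>
  have dec: "k (T + m) \<le> k T - real m * \<eta>" for m
  proof (induction m)
    case (Suc m)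
    then show ?case using step[of "T + m"] T[of "Suc (T + m)"] by (simp add: algebra_simps)
  qed simp
  obtain m where "k T < real m * \<eta>" using reals_Archimedean3[OF \<eta>(1)] by blast
  with dec[of m] k0[of "T + m"] show False by simp
qed

text \<open>
  A polynomial \<open>x\<close> plays the role of an element of the Hardy space, and the inner sums in \<open>bound\<close> are
  the coefficients \<open>v j x k\<close> of the projection of \<open>cnj F j * x\<close>. With \<open>S\<close> the backward shift and \<open>K\<close> the
  positive form \<open>\<Sum> |v|\<^sup>2 - c\<^sup>2 |x|\<^sup>2\<close>, the map sending \<open>(S x, v x 0)\<close> to \<open>(x, c * coeff x 0)\<close> is isometric.
  Composing it with an orthogonal projection gives a contraction \<open>L\<close> defined on all states and inputs;
  its impulse responses are the conjugated coefficients of the \<open>g j\<close>, and contractivity is the bound.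
\<close>

lemma lurking_isometry:
  fixes F :: "'i \<Rightarrow> nat \<Rightarrow> complex" and c :: real and n :: nat
  assumes I: "finite I" and c: "c > 0"
    and bound: "\<And>x::complex poly. (\<forall>k\<ge>Suc n. coeff x k = 0) \<Longrightarrow>
      2 * c\<^sup>2 * (\<Sum>k\<le>n. (cmod (coeff x k))\<^sup>2) \<le> (\<Sum>j\<in>I. \<Sum>k\<le>n. (cmod (\<Sum>i\<le>n. cnj (F j i) * coeff x (k + i)))\<^sup>2)"
  shows "\<exists>g. (\<forall>j\<in>I. \<forall>t. norm (g j t) \<le> 1) \<and>
    (\<forall>j\<in>I. \<forall>z. norm z < 1 \<longrightarrow> norm (\<Sum>t. g j t * z ^ t) \<le> 1) \<and>
    (\<forall>m\<le>n. (\<Sum>j\<in>I. \<Sum>t\<le>m. F j (m - t) * g j t) = (if m = 0 then of_real c else 0))"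
proof -
  define X where "X = {x::complex poly. \<forall>k\<ge>Suc n. coeff x k = 0}"
  define S where "S x = poly_shift 1 x" for x :: "complex poly"
  define v where "v j x k = (\<Sum>i\<le>n. cnj (F j i) * coeff x (k + i))" for j k and x :: "complex poly"
  define K where "K x y = (\<Sum>j\<in>I. \<Sum>k\<le>n. v j x k * cnj (v j y k)) - of_real (c\<^sup>2) * (\<Sum>k\<le>n. coeff x k * cnj (coeff y k))" for x y
  \<comment> \<open>The energy of the pair \<open>(x, c * coeff x 0)\<close>; orthonormality below
    always refers to \<open>Q\<close>.\<close>
  define Q where "Q x y = K x y + of_real (c\<^sup>2) * (coeff x 0 * cnj (coeff y 0))" for x y
  have S_coeff: "coeff (S x) k = coeff x (Suc k)" for x k by (simp add: S_def coeff_poly_shift)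
  have S_add: "S (x + y) = S x + S y" and S_smult: "S (smult a x) = smult a (S x)" for x y a
    by (simp_all add: poly_eq_iff S_coeff)
  have S_sum: "S (\<Sum>i\<in>A. h i) = (\<Sum>i\<in>A. S (h i))" for A :: "nat set" and h
    by (simp add: poly_eq_iff S_coeff coeff_sum)
  have v_add: "v j (x + y) k = v j x k + v j y k" and v_smult: "v j (smult a x) k = a * v j x k" for j x y a k
    by (simp_all add: v_def algebra_simps sum.distrib sum_distrib_left)
  have v_sum: "v j (\<Sum>i\<in>A. h i) k = (\<Sum>i\<in>A. v j (h i) k)" for A :: "nat set" and h j k
    unfolding v_def coeff_sum sum_distrib_left by (rule sum.swap)
  have v_S: "v j (S x) k = v j x (Suc k)" for j x k by (simp add: v_def S_coeff)
  have XS: "S x \<in> X" and X_smult: "smult a x \<in> X" if "x \<in> X" for x a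
    using that by (auto simp: X_def S_coeff)
  have X_add: "x + y \<in> X" if "x \<in> X" "y \<in> X" for x y
    using that by (auto simp: X_def)
  have X0: "0 \<in> X" by (simp add: X_def)
  have X_sum: "(\<Sum>i\<in>A. h i) \<in> X" if "\<And>i. i \<in> A \<Longrightarrow> h i \<in> X" for A :: "nat set" and h
    using that by (auto simp: X_def coeff_sum)
  have K_add: "K (x + y) z = K x z + K y z" and K_smult: "K (smult a x) z = a * K x z" for x y z a
    by (simp_all add: K_def v_add v_smult algebra_simps sum.distrib sum_distrib_left)
  have K_herm: "K y x = cnj (K x y)" for x y
    by (simp add: K_def mult.commute)
  have Q_add: "Q (x + y) z = Q x z + Q y z" and Q_smult: "Q (smult a x) z = a * Q x z" and Q_herm: "Q y x = cnj (Q x y)" for x y z a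
    by (simp_all add: Q_def K_add K_smult K_herm[of y x] algebra_simps)
  have K_smult2: "K x (smult a y) = cnj a * K x y" for x y a by (metis K_herm K_smult complex_cnj_mult)
  have K_0: "K 0 z = 0" for z using K_smult[of 0 0 z] by simp
  have K_sum2: "K x (\<Sum>i\<in>A. h i) = (\<Sum>i\<in>A. K x (h i))" for A :: "nat set" and h x
  proof -
    have "K (\<Sum>i\<in>A. h i) x = (\<Sum>i\<in>A. K (h i) x)"
      by (induction A rule: infinite_finite_induct) (auto simp: K_0 K_add)
    then have "cnj (K (\<Sum>i\<in>A. h i) x) = (\<Sum>i\<in>A. cnj (K (h i) x))" by simp
    then show ?thesis by (simp only: K_herm[symmetric])
  qed
  \<comment> \<open>Shifting removes the index 0 terms from both sums in \<open>K\<close>, and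
    nothing enters at the top because coefficients beyond \<open>n\<close> vanish. The added term in
    \<open>Q\<close> cancels the one lost from the sum with \<open>c\<^sup>2\<close>.\<close>
  have Q_shift: "Q x y = K (S x) (S y) + (\<Sum>j\<in>I. v j x 0 * cnj (v j y 0))" if "x \<in> X" "y \<in> X" for x y
  proof -
    have sh: "(\<Sum>k\<le>n. h k) = h 0 + (\<Sum>k\<le>n. h (Suc k))" if "h (Suc n) = 0" for h :: "nat \<Rightarrow> complex"
      using that sum.atMost_Suc_shift[of h n] by simp
    have "v j x (Suc n) = 0" for j using \<open>x \<in> X\<close> by (simp add: v_def X_def)
    then have 1: "(\<Sum>k\<le>n. v j x k * cnj (v j y k)) = v j x 0 * cnj (v j y 0) + (\<Sum>k\<le>n. v j (S x) k * cnj (v j (S y) k))" for j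
      by (subst sh) (auto simp: v_S)
    have 2: "(\<Sum>k\<le>n. coeff x k * cnj (coeff y k)) = coeff x 0 * cnj (coeff y 0) + (\<Sum>k\<le>n. coeff (S x) k * cnj (coeff (S y) k))"
      using \<open>x \<in> X\<close> by (subst sh) (auto simp: S_coeff X_def)
    show ?thesis unfolding Q_def K_def 1 2 by (simp only: sum.distrib ring_distribs add_ac) simp
  qed
  \<comment> \<open>The factor 2 in \<open>bound\<close> is spent here: \<open>K\<close> subtracts
    one copy of c^2 |x|^2 and the other makes \<open>K\<close> strictly positive, so that
    Gram-Schmidt applies to \<open>Q\<close>.\<close>
  have K_pos: "c\<^sup>2 * (\<Sum>k\<le>n. (cmod (coeff x k))\<^sup>2) \<le> Re (K x x)" if "x \<in> X" for x
  proof -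
    have "K x x = of_real ((\<Sum>j\<in>I. \<Sum>k\<le>n. (cmod (v j x k))\<^sup>2) - c\<^sup>2 * (\<Sum>k\<le>n. (cmod (coeff x k))\<^sup>2))"
      by (simp add: K_def complex_norm_square[symmetric])
    then have "Re (K x x) = (\<Sum>j\<in>I. \<Sum>k\<le>n. (cmod (v j x k))\<^sup>2) - c\<^sup>2 * (\<Sum>k\<le>n. (cmod (coeff x k))\<^sup>2)"
      by (simp only: Re_complex_of_real)
    moreover have "2 * c\<^sup>2 * (\<Sum>k\<le>n. (cmod (coeff x k))\<^sup>2) \<le> (\<Sum>j\<in>I. \<Sum>k\<le>n. (cmod (v j x k))\<^sup>2)"
      using bound[of x] that by (simp add: X_def v_def)
    ultimately show ?thesis by simp
  qed
  have K_nonneg: "0 \<le> Re (K x x)" if "x \<in> X" for x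
    by (rule order_trans[OF _ K_pos[OF that]]) (intro mult_nonneg_nonneg sum_nonneg zero_le_power2)
  have Re_Q: "Re (Q x x) = Re (K x x) + (cmod (of_real c * coeff x 0))\<^sup>2" for x
  proof -
    have "of_real (c\<^sup>2) * (coeff x 0 * cnj (coeff x 0)) = complex_of_real ((cmod (of_real c * coeff x 0))\<^sup>2)"
      by (simp add: complex_norm_square[symmetric] norm_mult power_mult_distrib)
    then show ?thesis by (simp add: Q_def del: of_real_power)
  qed
  have "0 < Re (Q p p)" if "p \<noteq> 0" "\<forall>k\<ge>Suc n. coeff p k = 0" for p
  proof -
    have "p \<in> X" using that by (simp add: X_def)
    obtain k where k: "coeff p k \<noteq> 0" using \<open>p \<noteq> 0\<close> by (auto simp: poly_eq_iff)
    then have "k \<le> n" using that(2) not_less_eq_eq by blast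
    then have "(cmod (coeff p k))\<^sup>2 \<le> (\<Sum>k\<le>n. (cmod (coeff p k))\<^sup>2)" by (intro member_le_sum) auto
    then have "0 < c\<^sup>2 * (\<Sum>k\<le>n. (cmod (coeff p k))\<^sup>2)"
      using k c by (intro mult_pos_pos) (auto intro: less_le_trans[rotated])
    then have "0 < Re (K p p)" using K_pos[OF \<open>p \<in> X\<close>] by linarith
    then show ?thesis unfolding Re_Q by (intro add_pos_nonneg) auto
  qed
  then have "\<exists>xs. (\<forall>i<Suc n. \<forall>k\<ge>Suc n. coeff (xs i) k = 0) \<and>
      (\<forall>i<Suc n. \<forall>j<Suc n. Q (xs i) (xs j) = of_bool (i = j)) \<and>
      (\<forall>p. (\<forall>k\<ge>Suc n. coeff p k = 0) \<longrightarrow> p = (\<Sum>i<Suc n. smult (Q p (xs i)) (xs i)))"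
    by (intro orthonormal_poly_basis Q_add Q_smult Q_herm)
  then obtain xs where xs: "\<forall>i<Suc n. \<forall>k\<ge>Suc n. coeff (xs i) k = 0"
      "\<forall>i<Suc n. \<forall>j<Suc n. Q (xs i) (xs j) = of_bool (i = j)"
      "\<forall>p. (\<forall>k\<ge>Suc n. coeff p k = 0) \<longrightarrow> p = (\<Sum>i<Suc n. smult (Q p (xs i)) (xs i))"
    by (elim exE conjE)
  have xsX: "xs i \<in> X" if "i \<le> n" for i using xs(1) that by (simp add: X_def)
  have on: "Q (xs i) (xs j) = of_bool (i = j)" if "i \<le> n" "j \<le> n" for i j
    using xs(2) that by simp
  have rep: "p = (\<Sum>i\<le>n. smult (Q p (xs i)) (xs i))" if "p \<in> X" for p
    by (rule xs(3)[rule_format, unfolded lessThan_Suc_atMost]) (use that in \<open>simp add: X_def\<close>)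

  \<comment> \<open>The contraction as the adjoint of the isometry\<close>
  define co where "co x b i = K x (S (xs i)) + (\<Sum>j\<in>I. b j * cnj (v j (xs i) 0))" for x b i
  \<comment> \<open>By \<open>Q_shift\<close> the pairs \<open>(S (xs i), v (xs i) 0)\<close> are
    orthonormal, and \<open>co x b i\<close> is the inner product of \<open>(x, b)\<close> with the
    i-th of them. So \<open>L\<close> is the adjoint of the isometry from \<open>y\<close> to
    \<open>(S y, v y 0)\<close>: it inverts it on its range and is defined on all pairs.\<close>
  define L where "L x b = (\<Sum>i\<le>n. smult (co x b i) (xs i))" for x b
  have L_X: "L x b \<in> X" for x b unfolding L_def by (intro X_sum X_smult xsX) auto
  have L_rep: "L (S x) (\<lambda>j. v j x 0) = x" if "x \<in> X" for x
  proof -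
    have "L (S x) (\<lambda>j. v j x 0) = (\<Sum>i\<le>n. smult (Q x (xs i)) (xs i))"
      unfolding L_def co_def using Q_shift[OF that xsX] by (intro sum.cong refl) simp
    also have "\<dots> = x" by (rule rep[OF that, symmetric])
    finally show ?thesis .
  qed
  \<comment> \<open>Bessel's inequality: with y = L x b, the squared norm of
    \<open>(x, b) - (S y, v y 0)\<close> is nonnegative. Its cross terms and its last square all
    equal \<open>E\<close>, the value of \<open>Q y y\<close>.\<close>
  have energy: "Re (K (L x b) (L x b)) + (cmod (of_real c * coeff (L x b) 0))\<^sup>2 \<le> Re (K x x) + (\<Sum>j\<in>I. (cmod (b j))\<^sup>2)"
    if x: "x \<in> X" for x b
  proof -
    define y where "y = L x b"
    have yX: "y \<in> X" by (simp add: y_def L_X)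
    have cross: "K x (S y) + (\<Sum>j\<in>I. b j * cnj (v j y 0)) = (\<Sum>i\<le>n. cnj (co x b i) * co x b i)"
    proof -
      have "(\<Sum>j\<in>I. b j * cnj (v j y 0)) = (\<Sum>j\<in>I. \<Sum>i\<le>n. cnj (co x b i) * (b j * cnj (v j (xs i) 0)))"
        unfolding y_def L_def v_sum v_smult cnj_sum complex_cnj_mult sum_distrib_left by (intro sum.cong refl) (simp add: mult_ac)
      also have "\<dots> = (\<Sum>i\<le>n. cnj (co x b i) * (\<Sum>j\<in>I. b j * cnj (v j (xs i) 0)))"
        unfolding sum_distrib_left by (rule sum.swap)
      finally show ?thesis
        unfolding co_def[of x b] ring_distribs
        by (simp only: y_def L_def S_sum S_smult K_sum2 K_smult2 sum.distrib ring_distribs co_def[symmetric])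
    qed
    have Qyx: "Q y (xs i) = co x b i" if i: "i \<le> n" for i
    proof -
      have "Q (\<Sum>l\<in>A. h l) r = (\<Sum>l\<in>A. Q (h l) r)" for A :: "nat set" and h r
        using Q_smult[of 0 0 r] by (induction A rule: infinite_finite_induct) (auto simp: Q_add)
      then have "Q y (xs i) = (\<Sum>l\<le>n. co x b l * of_bool (l = i))"
        unfolding y_def L_def using on i by (simp add: Q_smult)
      also have "\<dots> = co x b i" using i by (simp add: of_bool_def if_distrib[of "\<lambda>x. _ * x"] cong: if_cong)
      finally show ?thesis .
    qed
    have "K (S y) (S y) + (\<Sum>j\<in>I. v j y 0 * cnj (v j y 0)) = Q y y" using Q_shift[OF yX yX] by simp
    also have Qyy: "Q y y = (\<Sum>i\<le>n. cnj (co x b i) * co x b i)"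
    proof -
      have Q2: "Q z (\<Sum>l\<in>A. smult (a l) (h l)) = (\<Sum>l\<in>A. cnj (a l) * Q z (h l))" for A :: "nat set" and h a z
      proof -
        have "Q (\<Sum>l\<in>A. smult (a l) (h l)) z = (\<Sum>l\<in>A. a l * Q (h l) z)"
          using Q_smult[of 0 0 z] by (induction A rule: infinite_finite_induct) (auto simp: Q_add Q_smult)
        then have "cnj (Q (\<Sum>l\<in>A. smult (a l) (h l)) z) = (\<Sum>l\<in>A. cnj (a l) * cnj (Q (h l) z))" by simp
        then show ?thesis by (simp only: Q_herm[symmetric])
      qed
      have "Q y y = Q y (\<Sum>i\<le>n. smult (co x b i) (xs i))" by (simp add: y_def L_def)
      also have "\<dots> = (\<Sum>i\<le>n. cnj (co x b i) * co x b i)" unfolding Q2 using Qyx by simp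
      finally show ?thesis .
    qed
    finally have diag: "K (S y) (S y) + (\<Sum>j\<in>I. v j y 0 * cnj (v j y 0)) = (\<Sum>i\<le>n. cnj (co x b i) * co x b i)" .
    define E where "E = (\<Sum>i\<le>n. (cmod (co x b i))\<^sup>2)"
    have E: "(\<Sum>i\<le>n. cnj (co x b i) * co x b i) = of_real E"
      unfolding E_def by (simp add: complex_norm_square[symmetric] mult.commute[of "cnj _"])
    let ?d = "x + smult (-1) (S y)"
    have "?d \<in> X" by (intro X_add X_smult XS x yX)
    then have "0 \<le> Re (K ?d ?d) + (\<Sum>j\<in>I. (cmod (b j - v j y 0))\<^sup>2)"
      by (intro add_nonneg_nonneg K_nonneg sum_nonneg) auto
    also have "\<dots> = Re (K ?d ?d + (\<Sum>j\<in>I. (b j - v j y 0) * cnj (b j - v j y 0)))"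
      by (simp only: complex_norm_square[symmetric] plus_complex.sel Re_sum Re_complex_of_real)
    also have "K ?d ?d = K x x - K x (S y) - cnj (K x (S y)) + K (S y) (S y)"
    proof -
      have "K z (p + q) = K z p + K z q" for z p q by (metis K_herm K_add complex_cnj_add)
      then show ?thesis using K_herm[of "S y" x] by (simp add: K_add K_smult K_smult2 del: smult_minus_left)
    qed
    also have "(\<Sum>j\<in>I. (b j - v j y 0) * cnj (b j - v j y 0)) = (\<Sum>j\<in>I. b j * cnj (b j)) - (\<Sum>j\<in>I. b j * cnj (v j y 0)) - cnj (\<Sum>j\<in>I. b j * cnj (v j y 0)) + (\<Sum>j\<in>I. v j y 0 * cnj (v j y 0))"
      by (simp add: algebra_simps sum.distrib sum_subtractf)
    also have "K x x - K x (S y) - cnj (K x (S y)) + K (S y) (S y) + \<dots> =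
      K x x + (\<Sum>j\<in>I. b j * cnj (b j)) - (K x (S y) + (\<Sum>j\<in>I. b j * cnj (v j y 0))) - cnj (K x (S y) + (\<Sum>j\<in>I. b j * cnj (v j y 0))) + (K (S y) (S y) + (\<Sum>j\<in>I. v j y 0 * cnj (v j y 0)))"
      by (simp add: algebra_simps)
    also have "\<dots> = K x x + of_real (\<Sum>j\<in>I. (cmod (b j))\<^sup>2) - of_real E"
      unfolding cross diag E by (simp add: complex_norm_square[symmetric])
    finally have "E \<le> Re (K x x) + (\<Sum>j\<in>I. (cmod (b j))\<^sup>2)" by simp
    moreover have "Re (Q y y) = E" using Qyy E by simp
    ultimately show ?thesis using Re_Q[of y] by (simp add: y_def)
  qed

  \<comment> \<open>The linear system: state operator, inputs and impulse responses\<close>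
  define D where "D x = L x (\<lambda>_. 0)" for x
  define B where "B j = L 0 (\<lambda>i. of_bool (i = j))" for j
  have D_add: "D (x + y) = D x + D y" and D_smult: "D (smult a x) = smult a (D x)" for x y a
    unfolding D_def L_def co_def by (simp_all add: K_add K_smult smult_add_left sum.distrib smult_sum_right)
  have L_DB: "L x b = D x + (\<Sum>j\<in>I. smult (b j) (B j))" for x b
  proof -
    have cB: "co 0 (\<lambda>i. of_bool (i = j)) i = cnj (v j (xs i) 0)" if "j \<in> I" for i j
      using I that by (simp add: co_def K_0 of_bool_def if_distrib[of "\<lambda>x. x * _"] cong: if_cong)
    have "(\<Sum>j\<in>I. smult (b j) (B j)) = (\<Sum>j\<in>I. \<Sum>i\<le>n. smult (b j * cnj (v j (xs i) 0)) (xs i))"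
      unfolding B_def L_def by (intro sum.cong refl) (simp add: cB smult_sum_right)
    also have "\<dots> = (\<Sum>i\<le>n. smult (\<Sum>j\<in>I. b j * cnj (v j (xs i) 0)) (xs i))"
      unfolding smult_sum by (rule sum.swap)
    finally show ?thesis
      unfolding D_def L_def by (simp add: co_def smult_add_left sum.distrib)
  qed
  \<comment> \<open>The state \<open>t\<close> steps after a unit impulse in channel
    \<open>j\<close>.\<close>
  define P where "P t j = (D ^^ t) (B j)" for t j
  have Dt_add: "(D ^^ t) (x + y) = (D ^^ t) x + (D ^^ t) y" and Dt_smult: "(D ^^ t) (smult a x) = smult a ((D ^^ t) x)" for t x y a
    by (induction t) (auto simp: D_add D_smult)
  have Dt_sum: "(D ^^ t) (\<Sum>j\<in>A. h j) = (\<Sum>j\<in>A. (D ^^ t) (h j))" for t and A :: "'i set" and h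
    using Dt_smult[of t 0 0] by (induction A rule: infinite_finite_induct) (auto simp: Dt_add)
  have St: "coeff ((S ^^ t) x) k = coeff x (k + t)" for t x k
    by (induction t arbitrary: k) (auto simp: S_coeff)
  have StX: "(S ^^ t) x \<in> X" if "x \<in> X" for t x using that by (simp add: X_def St)
  \<comment> \<open>Each use of \<open>L_rep\<close> replaces the current shift of \<open>x\<close>
    by \<open>D\<close> of the next shift plus the inputs \<open>v j x t\<close>; unrolling it
    \<open>t\<close> times rebuilds \<open>x\<close> from its projected coefficients.\<close>
  have iter: "(D ^^ t) ((S ^^ t) x) + (\<Sum>s<t. \<Sum>j\<in>I. smult (v j x s) (P s j)) = x" if x: "x \<in> X" for x t
  proof (induction t)
    case (Suc t)
    define y where "y = (S ^^ t) x"
    have vS: "v j y 0 = v j x t" for j by (simp add: y_def v_def St add.commute)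
    have "y = L (S y) (\<lambda>j. v j y 0)" unfolding y_def by (rule L_rep[OF StX[OF x], symmetric])
    also have "\<dots> = D (S y) + (\<Sum>j\<in>I. smult (v j x t) (B j))" unfolding L_DB vS ..
    finally have "(D ^^ t) y = (D ^^ t) (D (S y) + (\<Sum>j\<in>I. smult (v j x t) (B j)))" by (rule arg_cong)
    also have "\<dots> = (D ^^ Suc t) (S y) + (\<Sum>j\<in>I. smult (v j x t) (P t j))"
      by (simp add: Dt_add Dt_sum Dt_smult P_def funpow_swap1)
    finally have step: "(D ^^ t) ((S ^^ t) x) = (D ^^ Suc t) ((S ^^ Suc t) x) + (\<Sum>j\<in>I. smult (v j x t) (P t j))"
      by (simp only: y_def funpow.simps o_apply)
    have "(D ^^ Suc t) ((S ^^ Suc t) x) + (\<Sum>s<Suc t. \<Sum>j\<in>I. smult (v j x s) (P s j)) =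
       (D ^^ t) ((S ^^ t) x) + (\<Sum>s<t. \<Sum>j\<in>I. smult (v j x s) (P s j))"
      unfolding step sum.lessThan_Suc by (simp only: add_ac)
    also have "\<dots> = x" by (rule Suc)
    finally show ?case .
  qed simp
  \<comment> \<open>After n + 1 shifts nothing of \<open>x\<close> remains, so the reconstruction
    has no remainder. Reading off coefficient 0 gives a formula for the output
    \<open>c * coeff x 0\<close> in terms of the \<open>v j x s\<close>.\<close>
  have rec: "of_real c * coeff x 0 = (\<Sum>s\<le>n. \<Sum>j\<in>I. v j x s * (of_real c * coeff (P s j) 0))" if x: "x \<in> X" for x
  proof -
    have "(S ^^ Suc n) x = 0" using x by (simp add: poly_eq_iff St X_def del: funpow.simps)
    moreover have "(D ^^ Suc n) 0 = 0" using Dt_smult[of "Suc n" 0 0] by (simp del: funpow.simps)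
    ultimately have "(\<Sum>s\<le>n. \<Sum>j\<in>I. smult (v j x s) (P s j)) = x"
      using iter[OF x, of "Suc n"] by (simp only: lessThan_Suc_atMost add_0)
    then have "coeff (\<Sum>s\<le>n. \<Sum>j\<in>I. smult (v j x s) (P s j)) 0 = coeff x 0" by (rule arg_cong)
    then have "of_real c * coeff x 0 = of_real c * (\<Sum>s\<le>n. \<Sum>j\<in>I. v j x s * coeff (P s j) 0)"
      by (simp add: coeff_sum)
    then show ?thesis by (simp only: sum_distrib_left mult.left_commute)
  qed
  have PX: "P t j \<in> X" for t j by (cases t) (auto simp: P_def D_def B_def L_X)
  have K_scale: "Re (K (smult a x) (smult a x)) = (cmod a)\<^sup>2 * Re (K x x)" for a x
  proof -
    have "K (smult a x) (smult a x) = of_real ((cmod a)\<^sup>2) * K x x"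
      unfolding K_smult K_smult2 complex_norm_square by (simp only: mult_ac)
    then show ?thesis by (simp del: of_real_power)
  qed
  have energy1: "Re (K (D x + smult a (B j)) (D x + smult a (B j))) + (cmod (of_real c * coeff (D x + smult a (B j)) 0))\<^sup>2
     \<le> Re (K x x) + (cmod a)\<^sup>2" if "x \<in> X" "j \<in> I" for x a j
  proof -
    have "L x (\<lambda>i. if i = j then a else 0) = D x + smult a (B j)"
      unfolding L_DB using I that by (simp add: if_distrib[of "\<lambda>x. smult x _"] cong: if_cong)
    moreover have "(\<Sum>i\<in>I. (cmod (if i = j then a else 0))\<^sup>2) = (cmod a)\<^sup>2"
      using I that by (simp add: if_distrib[of cmod] if_distrib[of "\<lambda>x. x\<^sup>2"] cong: if_cong)
    ultimately show ?thesis using energy[OF that(1), of "\<lambda>i. if i = j then a else 0"] by simp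
  qed
  define \<gamma> where "\<gamma> j t = of_real c * coeff (P t j) 0" for j t
  have \<gamma>1: "Re (K (P t j) (P t j)) + (cmod (\<gamma> j t))\<^sup>2 \<le> 1" if j: "j \<in> I" for t j
  proof (induction t)
    case 0
    have "D 0 = 0" using D_smult[of 0 0] by simp
    then show ?case using energy1[OF X0 j, of 1] K_0 by (simp add: \<gamma>_def P_def)
  next
    case (Suc t)
    have "Re (K (P (Suc t) j) (P (Suc t) j)) + (cmod (\<gamma> j (Suc t)))\<^sup>2 \<le> Re (K (P t j) (P t j))"
      using energy1[OF PX j, of t j 0] by (simp add: \<gamma>_def P_def)
    then show ?case using Suc by (smt (verit) zero_le_power2)
  qed
  have \<gamma>_le: "cmod (\<gamma> j t) \<le> 1" if j: "j \<in> I" for t j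
  proof -
    have "(cmod (\<gamma> j t))\<^sup>2 \<le> 1" using \<gamma>1[OF j, of t] K_nonneg[OF PX, of t j] by linarith
    then show ?thesis by (simp add: abs_square_le_1)
  qed
  have \<gamma>_sum: "cmod (\<Sum>t. \<gamma> j t * z ^ t) \<le> 1" if j: "j \<in> I" and z: "cmod z < 1" for j z
  proof -
    \<comment> \<open>Evaluating the response at \<open>z\<close> amounts to multiplying the state
      by \<open>z\<close> before each step while feeding the constant input 1. Since |z| < 1 this
      multiplication does not raise the energy, so the outputs, which are the partial sums, satisfy
      \<open>storage_limit_le_one\<close>.\<close>
    define \<xi> where "\<xi> T = (\<Sum>t\<le>T. smult (z ^ t) (P t j))" for T :: nat
    have \<xi>X: "\<xi> T \<in> X" for T unfolding \<xi>_def by (intro X_sum X_smult PX)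
    have D_sum: "D (\<Sum>t\<in>A. h t) = (\<Sum>t\<in>A. D (h t))" for A :: "nat set" and h
      using D_smult[of 0 0] by (induction A rule: infinite_finite_induct) (auto simp: D_add)
    have \<xi>_Suc: "\<xi> (Suc T) = D (smult z (\<xi> T)) + smult 1 (B j)" for T
      unfolding \<xi>_def sum.atMost_Suc_shift D_smult D_sum smult_sum_right by (simp add: P_def)
    have s_eq: "of_real c * coeff (\<xi> T) 0 = (\<Sum>t\<le>T. \<gamma> j t * z ^ t)" for T
      by (simp add: \<xi>_def coeff_sum \<gamma>_def sum_distrib_left mult_ac)
    have "summable (\<lambda>t. \<gamma> j t * z ^ t)"
    proof (rule summable_comparison_test')
      show "summable (\<lambda>t. cmod z ^ t)" using z by (simp add: summable_geometric)
      show "norm (\<gamma> j t * z ^ t) \<le> cmod z ^ t" for t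
        using \<gamma>_le[OF j, of t] by (simp add: norm_mult norm_power mult_left_le_one_le)
    qed
    then have lim: "(\<lambda>T. \<Sum>t\<le>T. \<gamma> j t * z ^ t) \<longlonglongrightarrow> (\<Sum>t. \<gamma> j t * z ^ t)"
      by (rule summable_LIMSEQ')
    have "(cmod (\<Sum>t. \<gamma> j t * z ^ t))\<^sup>2 \<le> 1"
    proof (rule storage_limit_le_one)
      show "0 \<le> Re (K (\<xi> T) (\<xi> T))" for T by (rule K_nonneg[OF \<xi>X])
      show "Re (K (\<xi> (Suc T)) (\<xi> (Suc T))) + (cmod (\<Sum>t\<le>Suc T. \<gamma> j t * z ^ t))\<^sup>2 \<le> Re (K (\<xi> T) (\<xi> T)) + 1" for T
      proof -
        have "(cmod z)\<^sup>2 * Re (K (\<xi> T) (\<xi> T)) \<le> Re (K (\<xi> T) (\<xi> T))"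
          using z K_nonneg[OF \<xi>X] by (intro mult_left_le_one_le) (auto simp: power_le_one)
        then show ?thesis
          using energy1[OF X_smult[OF \<xi>X] j, of z T 1] unfolding \<xi>_Suc[symmetric] K_scale s_eq by simp
      qed
      show "(\<lambda>T. (cmod (\<Sum>t\<le>T. \<gamma> j t * z ^ t))\<^sup>2) \<longlonglongrightarrow> (cmod (\<Sum>t. \<gamma> j t * z ^ t))\<^sup>2"
        by (intro tendsto_intros lim)
    qed
    then show ?thesis by (simp add: abs_square_le_1)
  qed

  \<comment> \<open>Reading off the solutions\<close>
  show ?thesis
  proof (intro exI[of _ "\<lambda>j t. cnj (\<gamma> j t)"] conjI ballI allI impI)
    fix j t assume "j \<in> I"
    then show "cmod (cnj (\<gamma> j t)) \<le> 1" using \<gamma>_le by simp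
  next
    fix j z assume j: "j \<in> I" and z: "cmod z < 1"
    have "summable (\<lambda>t. \<gamma> j t * cnj z ^ t)"
    proof (rule summable_comparison_test')
      show "summable (\<lambda>t. cmod z ^ t)" using z by (simp add: summable_geometric)
      show "norm (\<gamma> j t * cnj z ^ t) \<le> cmod z ^ t" for t
        using \<gamma>_le[OF j, of t] by (simp add: norm_mult norm_power mult_left_le_one_le)
    qed
    then have "(\<lambda>t. cnj (\<gamma> j t * cnj z ^ t)) sums cnj (\<Sum>t. \<gamma> j t * cnj z ^ t)"
      by (intro sums_cnj[THEN iffD2] summable_sums)
    then have "(\<Sum>t. cnj (\<gamma> j t) * z ^ t) = cnj (\<Sum>t. \<gamma> j t * cnj z ^ t)"
      by (simp add: sums_iff)
    then show "cmod (\<Sum>t. cnj (\<gamma> j t) * z ^ t) \<le> 1" using \<gamma>_sum[OF j, of "cnj z"] z by simp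
  next
    fix m assume m: "m \<le> n"
    \<comment> \<open>For the monomial of degree \<open>m\<close>, \<open>v j x s\<close> is the
      conjugate of \<open>F j (m - s)\<close>, so \<open>rec\<close> becomes the conjugate of the
      m-th coefficient equation of the product. This is why the solution has the conjugates of
      \<open>\<gamma>\<close> as coefficients.\<close>
    have "monom 1 m \<in> X" using m by (simp add: X_def)
    note r = rec[OF this]
    have vm: "v j (monom 1 m) s = (if s \<le> m then cnj (F j (m - s)) else 0)" for j s
    proof -
      have "v j (monom 1 m) s = (\<Sum>i\<le>n. if i = m - s \<and> s \<le> m then cnj (F j i) else 0)"
        unfolding v_def by (intro sum.cong) auto
      also have "\<dots> = (if s \<le> m then cnj (F j (m - s)) else 0)" using m by (cases "s \<le> m") auto
      finally show ?thesis .
    qed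
    have "(\<Sum>s\<le>n. \<Sum>j\<in>I. v j (monom 1 m) s * (of_real c * coeff (P s j) 0)) = (\<Sum>s\<le>n. if s \<le> m then (\<Sum>j\<in>I. cnj (F j (m - s)) * \<gamma> j s) else 0)"
      by (intro sum.cong refl) (simp add: vm \<gamma>_def)
    also have "\<dots> = (\<Sum>s\<le>m. \<Sum>j\<in>I. cnj (F j (m - s)) * \<gamma> j s)"
      using m by (intro sum.mono_neutral_cong_right) auto
    also have "\<dots> = (\<Sum>j\<in>I. \<Sum>s\<le>m. cnj (F j (m - s)) * \<gamma> j s)" by (rule sum.swap)
    finally have "(\<Sum>j\<in>I. \<Sum>s\<le>m. cnj (F j (m - s)) * \<gamma> j s) = of_real c * coeff (monom 1 m) 0"
      using r by (simp only:)
    also have "\<dots> = (if m = 0 then of_real c else 0)" by simp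
    finally have "(\<Sum>j\<in>I. \<Sum>s\<le>m. cnj (F j (m - s)) * \<gamma> j s) = (if m = 0 then of_real c else 0)" .
    then have "cnj (\<Sum>j\<in>I. \<Sum>s\<le>m. cnj (F j (m - s)) * \<gamma> j s) = (if m = 0 then of_real c else 0)"
      by (simp split: if_splits)
    then show "(\<Sum>j\<in>I. \<Sum>t\<le>m. F j (m - t) * cnj (\<gamma> j t)) = (if m = 0 then complex_of_real c else 0)"
      by simp
  qed
qed

section \<open>Polynomial approximation and the limit\<close>

lemma circ_int_cnj:
  assumes "continuous_on (sphere 0 1) F"
  shows "circ_int (\<lambda>z. cnj (F z)) = cnj (circ_int F)"
  unfolding circ_int_def using integral_linear[OF circ_integrable[OF assms] bounded_linear_cnj]
  by (simp add: o_def)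

lemma circ_int_const_one: "circ_int (\<lambda>z. 1::complex) = of_real (2 * pi)"
  by (simp add: circ_int_def scaleR_conv_of_real)

lemma unit_circle_mult_cnj:
  assumes "norm z = 1"
  shows "z * cnj z = 1"
  using assms complex_norm_square[of z] by simp

text \<open>On the circle the integrand is \<open>z\<close> times the holomorphic
  \<open>z ^ m\<close>, so Stokes' formula leaves the area integral of 0.\<close>

lemma circ_int_monomials_gt:
  assumes "l < k"
  shows "circ_int (\<lambda>z. z ^ k * cnj z ^ l) = 0"
proof -
  define m where "m = k - l - 1"
  have k: "k = Suc m + l" using assms by (simp add: m_def)
  have "circ_int (\<lambda>z. z ^ k * cnj z ^ l) = circ_int (\<lambda>z. z * z ^ m)"
  proof (rule circ_int_cong)
    fix z :: complex assume "norm z = 1"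
    then have "z ^ l * cnj z ^ l = 1" by (metis unit_circle_mult_cnj power_mult_distrib power_one)
    then show "z ^ k * cnj z ^ l = z * z ^ m" by (simp add: k power_add mult_ac)
  qed
  also have "\<dots> = area_int (\<lambda>z. 2 * 0)"
    by (rule stokes_disc[where A="\<lambda>z. of_nat m * z ^ (m - 1)"])
       (auto intro!: derivative_eq_intros continuous_intros simp: has_field_derivative_def[symmetric])
  finally show ?thesis by (simp add: area_int_def)
qed

lemma circ_int_monomials:
  "circ_int (\<lambda>z. z ^ k * cnj z ^ l) = (if k = l then of_real (2 * pi) else 0)"
proof (cases k l rule: linorder_cases)
  case less
  have "circ_int (\<lambda>z. z ^ k * cnj z ^ l) = circ_int (\<lambda>z. cnj (z ^ l * cnj z ^ k))"
    by (simp add: mult.commute)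
  also have "\<dots> = 0"
    using less by (subst circ_int_cnj) (auto intro!: continuous_intros simp: circ_int_monomials_gt)
  finally show ?thesis using less by simp
next
  case equal
  have "circ_int (\<lambda>z. z ^ k * cnj z ^ l) = circ_int (\<lambda>z. 1)"
    using equal by (intro circ_int_cong) (metis unit_circle_mult_cnj power_mult_distrib power_one)
  then show ?thesis using equal circ_int_const_one by simp
qed (simp add: circ_int_monomials_gt)

lemma parseval_circle:
  "circ_int (\<lambda>z. (cmod (\<Sum>k\<le>n. a k * z ^ k))\<^sup>2) = 2 * pi * (\<Sum>k\<le>n. (cmod (a k))\<^sup>2)"
proof -
  have "complex_of_real (circ_int (\<lambda>z. (cmod (\<Sum>k\<le>n. a k * z ^ k))\<^sup>2)) =
     circ_int (\<lambda>z. complex_of_real ((cmod (\<Sum>k\<le>n. a k * z ^ k))\<^sup>2))"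
    by (intro circ_int_of_real[symmetric] continuous_intros)
  also have "\<dots> = circ_int (\<lambda>z. \<Sum>k\<le>n. \<Sum>l\<le>n. (a k * cnj (a l)) * (z ^ k * cnj z ^ l))"
    unfolding complex_norm_square cnj_sum sum_product by (simp add: mult_ac)
  also have "\<dots> = (\<Sum>k\<le>n. \<Sum>l\<le>n. (a k * cnj (a l)) * circ_int (\<lambda>z. z ^ k * cnj z ^ l))"
    by (subst circ_int_sum, simp, intro continuous_intros, intro sum.cong refl, subst circ_int_sum, simp, intro continuous_intros)
       (simp add: circ_int_def)
  also have "\<dots> = (\<Sum>k\<le>n. a k * cnj (a k) * of_real (2 * pi))"
    by (simp add: circ_int_monomials if_distrib[of "\<lambda>x. _ * x"] cong: if_cong)
  also have "\<dots> = complex_of_real (2 * pi * (\<Sum>k\<le>n. (cmod (a k))\<^sup>2))"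
    by (simp add: complex_norm_square[symmetric] sum_distrib_left mult.commute)
  finally show ?thesis unfolding of_real_eq_iff .
qed

lemma sum_shift_support:
  fixes h :: "nat \<Rightarrow> 'a::comm_monoid_add"
  assumes "\<And>k. k > n \<Longrightarrow> h k = 0"
  shows "(\<Sum>k\<le>n. if i \<le> k then h k else 0) = (\<Sum>l\<le>n. h (l + i))"
proof -
  have "(\<Sum>l\<le>n. h (l + i)) = (\<Sum>k\<in>{i..n+i}. h k)"
    by (rule sum.reindex_bij_witness[of _ "\<lambda>k. k - i" "\<lambda>l. l + i"]) auto
  also have "\<dots> = (\<Sum>k\<le>n. if i \<le> k then h k else 0)"
    using assms by (intro sum.mono_neutral_cong) auto
  finally show ?thesis by simp
qed

text \<open>Parseval translates \<open>corona_L2_estimate\<close> into coefficients, the form in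
  which the isometry argument takes it. The constants involve neither \<open>M\<close> nor
  \<open>n\<close>.\<close>

lemma polynomial_corona_estimate:
  fixes F :: "'i \<Rightarrow> nat \<Rightarrow> complex" and x :: "complex poly"
  assumes I: "finite I" "I \<noteq> {}" and d: "d > 0"
    and F0: "\<And>j i. i > M \<Longrightarrow> F j i = 0"
    and f1: "\<And>j z. j \<in> I \<Longrightarrow> norm z \<le> 1 \<Longrightarrow> norm (\<Sum>i\<le>M. F j i * z ^ i) \<le> 1"
    and lower: "\<And>z. norm z \<le> 1 \<Longrightarrow> d \<le> (\<Sum>j\<in>I. (cmod (\<Sum>i\<le>M. F j i * z ^ i))\<^sup>2)"
    and x: "\<forall>k\<ge>Suc n. coeff x k = 0"
    and N: "N = real (card I)" and e: "e = 1 / d\<^sup>2 + 2 / d ^ 3"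
    and a: "a = N / d + 17 * e * N\<^sup>2" and b: "b = 1 / d + 4 * N * e * (17 + 2 * N\<^sup>2)"
  shows "(\<Sum>k\<le>n. (cmod (coeff x k))\<^sup>2) \<le>
    4 * a * b * (\<Sum>j\<in>I. \<Sum>k\<le>n. (cmod (\<Sum>i\<le>n. cnj (F j i) * coeff x (k + i)))\<^sup>2)"
proof -
  define f where "f j z = (\<Sum>i\<le>M. F j i * z ^ i)" for j z
  define u where "u z = (\<Sum>k\<le>n. coeff x k * z ^ k)" for z
  define vc where "vc j k = (\<Sum>i\<le>n. cnj (F j i) * coeff x (k + i))" for j k
  define v where "v j z = (\<Sum>k\<le>n. vc j k * z ^ k)" for j z
  \<comment> \<open>On the circle f_j * cnj u is a sum of powers with exponent i - k. Exponents at
    most 0 form the conjugate of \<open>v j\<close>; the positive ones form \<open>z * W j\<close>,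
    whence the extra -1 in the exponent.\<close>
  define W where "W j z = (\<Sum>i\<le>M. \<Sum>k\<le>n. if k < i then F j i * cnj (coeff x k) * z ^ (i - k - 1) else 0)" for j z
  have bd: "f j z * cnj (u z) = cnj (v j z) + z * W j z" if z: "norm z = 1" for j z
  proof -
    define h where "h i k = F j i * cnj (coeff x k) * cnj z ^ (k - i)" for i k
    have "cnj (v j z) = (\<Sum>l\<le>n. \<Sum>i\<le>n. h i (l + i))"
      by (simp add: v_def vc_def h_def sum_distrib_right)
    also have "\<dots> = (\<Sum>i\<le>n. \<Sum>l\<le>n. h i (l + i))" by (rule sum.swap)
    also have "\<dots> = (\<Sum>i\<le>n. \<Sum>k\<le>n. if i \<le> k then h i k else 0)"
      using x by (intro sum.cong refl sum_shift_support[symmetric]) (auto simp: h_def)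
    \<comment> \<open>The ranges of \<open>i\<close> may differ: beyond \<open>n\<close> no k \<le>
      n satisfies i \<le> k, and beyond \<open>M\<close> the coefficients of \<open>F\<close>
      vanish.\<close>
    also have "\<dots> = (\<Sum>i\<le>M. \<Sum>k\<le>n. if i \<le> k then h i k else 0)"
      using F0 by (intro sum.mono_neutral_cong) (auto simp: h_def intro!: sum.neutral)
    finally have v: "cnj (v j z) = \<dots>" .
    have W: "z * W j z = (\<Sum>i\<le>M. \<Sum>k\<le>n. if k < i then F j i * cnj (coeff x k) * z ^ (i - k) else 0)"
      unfolding W_def sum_distrib_left
      by (intro sum.cong refl) (auto simp: power_Suc[symmetric] Suc_diff_Suc simp del: power_Suc)
    have "f j z * cnj (u z) = (\<Sum>i\<le>M. \<Sum>k\<le>n. F j i * cnj (coeff x k) * (z ^ i * cnj z ^ k))"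
      unfolding f_def u_def cnj_sum sum_product by (simp add: mult_ac)
    also have "\<dots> = (\<Sum>i\<le>M. \<Sum>k\<le>n. (if i \<le> k then h i k else 0) + (if k < i then F j i * cnj (coeff x k) * z ^ (i - k) else 0))"
    proof (intro sum.cong refl)
      fix i k
      have one: "z ^ m * cnj z ^ m = 1" for m using unit_circle_mult_cnj[OF z] by (metis power_mult_distrib power_one)
      show "F j i * cnj (coeff x k) * (z ^ i * cnj z ^ k) = (if i \<le> k then h i k else 0) + (if k < i then F j i * cnj (coeff x k) * z ^ (i - k) else 0)"
      proof (cases "i \<le> k")
        case True
        then have "z ^ i * cnj z ^ k = (z ^ i * cnj z ^ i) * cnj z ^ (k - i)" by (simp add: power_add[symmetric] mult.assoc)
        then show ?thesis using True by (simp only: one) (simp add: h_def)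
      next
        case False
        then have "z ^ i * cnj z ^ k = z ^ (i - k) * (z ^ k * cnj z ^ k)" by (simp add: power_add[symmetric] mult.assoc[symmetric])
        then show ?thesis using False by (simp only: one) simp
      qed
    qed
    also have "\<dots> = cnj (v j z) + z * W j z" unfolding v W by (simp add: sum.distrib)
    finally show ?thesis .
  qed
  have hu: "u holomorphic_on UNIV" unfolding u_def by (intro holomorphic_intros)
  have hf: "f j holomorphic_on UNIV" for j unfolding f_def by (intro holomorphic_intros)
  have hW: "W j holomorphic_on UNIV" for j
    unfolding W_def
  proof (intro holomorphic_intros)
    fix i k show "(\<lambda>z. if k < i then F j i * cnj (coeff x k) * z ^ (i - k - 1) else 0) holomorphic_on UNIV"
      by (cases "k < i") (auto intro!: holomorphic_intros)
  qed
  have "circ_int (\<lambda>z. (cmod (u z))\<^sup>2) \<le> 4 * a * b * (\<Sum>j\<in>I. circ_int (\<lambda>z. (cmod (v j z))\<^sup>2))"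
  proof (rule corona_L2_estimate[OF I d hf hW hu _ _ _ bd N e a b])
    show "continuous_on (sphere 0 1) (v j)" for j unfolding v_def by (intro continuous_intros)
  qed (use f1 lower in \<open>auto simp: f_def\<close>)
  then have "2 * pi * (\<Sum>k\<le>n. (cmod (coeff x k))\<^sup>2) \<le> 4 * a * b * (\<Sum>j\<in>I. 2 * pi * (\<Sum>k\<le>n. (cmod (vc j k))\<^sup>2))"
    unfolding u_def v_def parseval_circle .
  also have "\<dots> = 2 * pi * (4 * a * b * (\<Sum>j\<in>I. \<Sum>k\<le>n. (cmod (vc j k))\<^sup>2))"
    by (simp add: sum_distrib_left mult_ac)
  finally show ?thesis unfolding vc_def by (simp only: mult_le_cancel_left_pos[OF pi_gt_zero] mult.assoc mult_le_cancel_left_pos[OF zero_less_numeral])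
qed

text \<open>From Parseval. The bound is uniform in the degree and later controls the tail of the
  product series.\<close>

lemma coefficient_bound_circle:
  fixes a :: "nat \<Rightarrow> complex"
  assumes "\<And>z. norm z = 1 \<Longrightarrow> norm (\<Sum>i\<le>M. a i * z ^ i) \<le> 1" "i \<le> M"
  shows "norm (a i) \<le> 1"
proof -
  have "2 * pi * (\<Sum>k\<le>M. (cmod (a k))\<^sup>2) \<le> circ_int (\<lambda>z. 1)"
    unfolding parseval_circle[symmetric] using assms by (intro circ_int_mono continuous_intros) (auto simp: power_le_one)
  then have "(\<Sum>k\<le>M. (cmod (a k))\<^sup>2) \<le> 1" by (simp add: circ_int_def)
  moreover have "(cmod (a i))\<^sup>2 \<le> (\<Sum>k\<le>M. (cmod (a k))\<^sup>2)" using assms by (intro member_le_sum) auto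
  ultimately have "(cmod (a i))\<^sup>2 \<le> 1" by linarith
  then show ?thesis by (simp add: abs_square_le_1)
qed

lemma taylor_dilation_uniform:
  assumes h: "h holomorphic_on ball 0 1" and s: "0 < s" "s < 1" and \<epsilon>: "\<epsilon> > 0"
  shows "\<forall>\<^sub>F M in sequentially. \<forall>z. norm z \<le> 1 \<longrightarrow>
    norm ((\<Sum>i\<le>M. ((deriv ^^ i) h 0 / fact i * of_real s ^ i) * z ^ i) - h (of_real s * z)) < \<epsilon>"
proof -
  define c where "c i = (deriv ^^ i) h 0 / fact i" for i
  have sums: "(\<lambda>i. c i * w ^ i) sums h w" if "norm w < 1" for w
    using holomorphic_power_series[OF h, of w] that by (simp add: c_def)
  \<comment> \<open>A radius strictly between \<open>s\<close> and 1: convergence there gives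
    absolute convergence at \<open>s\<close>, hence a majorant for the M-test.\<close>
  define r where "r = (1 + s) / 2"
  have r: "s < r" "r < 1" "0 < r" using s by (auto simp: r_def)
  have "summable (\<lambda>i. norm (c i * of_real s ^ i))"
    using sums[of "of_real r"] r s by (intro powser_insidea[where x="of_real r"]) (auto simp: sums_iff)
  then have "uniform_limit (cball 0 1) (\<lambda>M z. \<Sum>i<M. c i * (of_real s * z) ^ i) (\<lambda>z. \<Sum>i. c i * (of_real s * z) ^ i) sequentially"
  proof (rule Weierstrass_m_test[rotated])
    fix i and z :: complex assume "z \<in> cball 0 1"
    then have "norm z ^ i \<le> 1" by (auto simp: power_le_one)
    then have "norm (c i * of_real s ^ i) * norm z ^ i \<le> norm (c i * of_real s ^ i) * 1"
      by (rule mult_left_mono) simp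
    then show "norm (c i * (of_real s * z) ^ i) \<le> norm (c i * of_real s ^ i)"
      by (simp add: norm_mult norm_power power_mult_distrib mult_ac)
  qed
  from uniform_limitD[OF this \<epsilon>]
  have "\<forall>\<^sub>F M in sequentially. \<forall>z\<in>cball 0 1. dist (\<Sum>i<Suc M. c i * (of_real s * z) ^ i) (\<Sum>i. c i * (of_real s * z) ^ i) < \<epsilon>"
    by (rule eventually_compose_filterlim[OF _ filterlim_Suc])
  then show ?thesis
  proof (rule eventually_mono, intro allI impI)
    fix M and z :: complex
    assume *: "\<forall>z\<in>cball 0 1. dist (\<Sum>i<Suc M. c i * (of_real s * z) ^ i) (\<Sum>i. c i * (of_real s * z) ^ i) < \<epsilon>" and z: "norm z \<le> 1"
    have "norm (of_real s * z) \<le> s" using z s by (simp add: norm_mult mult_left_le)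
    then have "norm (of_real s * z) < 1" using s by linarith
    then have 1: "(\<Sum>i. c i * (of_real s * z) ^ i) = h (of_real s * z)" using sums by (simp add: sums_iff)
    have 2: "(\<Sum>i<Suc M. c i * (of_real s * z) ^ i) = (\<Sum>i\<le>M. (c i * of_real s ^ i) * z ^ i)"
      by (simp only: lessThan_Suc_atMost power_mult_distrib mult_ac)
    have "z \<in> cball 0 1" using z by simp
    with * have "dist (\<Sum>i<Suc M. c i * (of_real s * z) ^ i) (\<Sum>i. c i * (of_real s * z) ^ i) < \<epsilon>"
      by (rule bspec)
    then show "norm ((\<Sum>i\<le>M. ((deriv ^^ i) h 0 / fact i * of_real s ^ i) * z ^ i) - h (of_real s * z)) < \<epsilon>"
      unfolding 1 2 dist_norm by (simp only: c_def)
  qed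
qed

text \<open>Montel's theorem is applied once per index, each time along the subsequence already
  chosen; earlier limits survive the refinement.\<close>

lemma montel_finite_family:
  fixes G :: "nat \<Rightarrow> 'i \<Rightarrow> complex \<Rightarrow> complex"
  assumes "finite I" "open S"
    and "\<And>n j. j \<in> I \<Longrightarrow> G n j holomorphic_on S"
    and "\<And>n j z. j \<in> I \<Longrightarrow> z \<in> S \<Longrightarrow> norm (G n j z) \<le> B"
  shows "\<exists>r::nat \<Rightarrow> nat. strict_mono r \<and> (\<forall>j\<in>I. \<exists>g. g holomorphic_on S \<and> (\<forall>z\<in>S. (\<lambda>n. G (r n) j z) \<longlonglongrightarrow> g z))"
  using assms(1,3,4)
proof (induction I rule: finite_induct)
  case empty
  then show ?case by (auto intro!: exI[of _ id] simp: strict_mono_def)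
next
  case (insert j I)
  then obtain r :: "nat \<Rightarrow> nat" where r: "strict_mono r"
    and lim: "\<And>i. i \<in> I \<Longrightarrow> \<exists>g. g holomorphic_on S \<and> (\<forall>z\<in>S. (\<lambda>n. G (r n) i z) \<longlonglongrightarrow> g z)"
    by (metis insertCI)
  obtain g q where g: "g holomorphic_on S" "strict_mono (q :: nat \<Rightarrow> nat)"
      "\<And>z. z \<in> S \<Longrightarrow> ((\<lambda>n. G (r (q n)) j z) \<longlonglongrightarrow> g z)"
  proof (rule Montel[OF assms(2), of "range (\<lambda>n. G (r n) j)" "\<lambda>n. G (r n) j"])
    show "\<exists>B. \<forall>h\<in>range (\<lambda>n. G (r n) j). \<forall>z\<in>K. norm (h z) \<le> B" if "compact K" "K \<subseteq> S" for K
      using insert.prems(2) that by (intro exI[of _ B]) auto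
  qed (use insert.prems(1) in auto)
  show ?case
  proof (intro exI[of _ "r \<circ> q"] conjI ballI)
    show "strict_mono (r \<circ> q)" using r g(2) by (rule strict_mono_o)
    fix i assume "i \<in> insert j I"
    then show "\<exists>g. g holomorphic_on S \<and> (\<forall>z\<in>S. (\<lambda>n. G ((r \<circ> q) n) i z) \<longlonglongrightarrow> g z)"
    proof (cases "i = j")
      case True
      then show ?thesis using g by auto
    next
      case False
      then obtain k where k: "k holomorphic_on S" "\<forall>z\<in>S. (\<lambda>n. G (r n) i z) \<longlonglongrightarrow> k z"
        using lim \<open>i \<in> insert j I\<close> by blast
      have "(\<lambda>n. G (r (q n)) i z) \<longlonglongrightarrow> k z" if "z \<in> S" for z
        using LIMSEQ_subseq_LIMSEQ[OF k(2)[rule_format, OF that] g(2)] by (simp add: o_def)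
      then show ?thesis using k(1) by auto
    qed
  qed
qed

text \<open>The choice of \<open>c\<close> makes 2 c^2 * 4ab equal to 1, which turns the corona
  estimate into the hypothesis of \<open>lurking_isometry\<close>. Neither \<open>c\<close> nor the
  error bound depends on \<open>s\<close> or \<open>\<epsilon>\<close>, so all three parameters can
  go to their limits together.\<close>

lemma corona_approximate_solution:
  fixes h :: "'i \<Rightarrow> complex \<Rightarrow> complex"
  assumes I: "finite I" "I \<noteq> {}" and \<delta>: "\<delta> > 0"
    and hol: "\<And>j. j \<in> I \<Longrightarrow> h j holomorphic_on ball 0 1"
    and hb: "\<And>j z. j \<in> I \<Longrightarrow> norm z < 1 \<Longrightarrow> norm (h j z) \<le> 1 / 2"
    and lower: "\<And>z. norm z < 1 \<Longrightarrow> \<delta> \<le> (\<Sum>j\<in>I. norm (h j z))"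
    and N: "N = real (card I)" and d: "d = (\<delta> / 2)\<^sup>2 / N" and e: "e = 1 / d\<^sup>2 + 2 / d ^ 3"
    and a: "a = N / d + 17 * e * N\<^sup>2" and b: "b = 1 / d + 4 * N * e * (17 + 2 * N\<^sup>2)"
    and c: "c = sqrt (1 / (8 * a * b))"
    and s: "0 < s" "s < 1" and \<epsilon>: "\<epsilon> > 0"
  shows "\<exists>p g. (\<forall>j\<in>I. \<forall>z. norm z \<le> 1 \<longrightarrow> norm (p j z - h j (of_real s * z)) < \<epsilon>) \<and>
    (\<forall>j\<in>I. g j holomorphic_on ball 0 1) \<and> (\<forall>j\<in>I. \<forall>z. norm z < 1 \<longrightarrow> norm (g j z) \<le> 1) \<and>
    (\<forall>z. norm z < 1 \<longrightarrow> norm ((\<Sum>j\<in>I. p j z * g j z) - of_real c) \<le> N * (\<Sum>m. real (Suc (m + Suc n)) * norm z ^ (m + Suc n)))"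
proof -
  have N1: "1 \<le> N" using I by (simp add: N Suc_leI card_gt_0_iff)
  have d0: "d > 0" using \<delta> N1 by (simp add: d)
  have e0: "e > 0" using d0 by (simp add: e add_pos_pos)
  have a0: "a > 0" and b0: "b > 0" using d0 e0 N1 by (auto simp: a b intro!: add_pos_pos mult_pos_pos)
  have c0: "c > 0" using a0 b0 by (simp add: c)
  \<comment> \<open>The margin 1/2 keeps the polynomials bounded by 1. The margin
    \<open>\<delta> / (2 * N)\<close>, summed over the indices, costs half of
    \<open>\<delta>\<close>; Cauchy-Schwarz then gives the bound \<open>d\<close> for the sum of
    squares.\<close>
  define \<epsilon>' where "\<epsilon>' = min \<epsilon> (min (1/2) (\<delta> / (2 * N)))"
  have \<epsilon>': "\<epsilon>' > 0" "\<epsilon>' \<le> \<epsilon>" "\<epsilon>' \<le> 1/2" "\<epsilon>' \<le> \<delta> / (2 * N)" using \<epsilon> \<delta> N1 by (auto simp: \<epsilon>'_def)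
  define C where "C j i = (deriv ^^ i) (h j) 0 / fact i * of_real s ^ i" for j i
  have "\<forall>\<^sub>F M in sequentially. \<forall>j\<in>I. \<forall>z. norm z \<le> 1 \<longrightarrow> norm ((\<Sum>i\<le>M. C j i * z ^ i) - h j (of_real s * z)) < \<epsilon>'"
    unfolding C_def by (intro eventually_ball_finite I ballI taylor_dilation_uniform hol s \<epsilon>')
  then obtain M where M: "\<And>j z. j \<in> I \<Longrightarrow> norm z \<le> 1 \<Longrightarrow> norm ((\<Sum>i\<le>M. C j i * z ^ i) - h j (of_real s * z)) < \<epsilon>'"
    using eventually_happens' trivial_limit_sequentially by blast
  define F where "F j i = (if i \<le> M then C j i else 0)" for j i
  define p where "p j z = (\<Sum>i\<le>M. F j i * z ^ i)" for j z
  have p_eq: "p j z = (\<Sum>i\<le>M. C j i * z ^ i)" for j z by (simp add: p_def F_def)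
  have close: "norm (p j z - h j (of_real s * z)) < \<epsilon>'" if "j \<in> I" "norm z \<le> 1" for j z
    using M[OF that] by (simp add: p_eq)
  have sz: "norm (of_real s * z) < 1" if "norm z \<le> 1" for z :: complex
  proof -
    have "norm (of_real s * z) \<le> s" using that s by (simp add: norm_mult mult_left_le)
    then show ?thesis using s by linarith
  qed
  have p1: "norm (p j z) \<le> 1" if j: "j \<in> I" and z: "norm z \<le> 1" for j z
    using close[OF j z] hb[OF j sz[OF z]] \<epsilon>'(3) norm_triangle_sub[of "p j z" "h j (of_real s * z)"] by linarith
  have pl: "d \<le> (\<Sum>j\<in>I. (cmod (p j z))\<^sup>2)" if z: "norm z \<le> 1" for z
  proof -
    have "\<delta> \<le> (\<Sum>j\<in>I. norm (h j (of_real s * z)))" by (rule lower[OF sz[OF z]])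
    also have "\<dots> \<le> (\<Sum>j\<in>I. norm (p j z) + \<delta> / (2 * N))"
    proof (rule sum_mono)
      fix j assume "j \<in> I"
      then show "norm (h j (of_real s * z)) \<le> norm (p j z) + \<delta> / (2 * N)"
        using close[OF _ z, of j] \<epsilon>'(4) norm_triangle_sub[of "h j (of_real s * z)" "p j z"]
        by (simp add: norm_minus_commute)
    qed
    also have "\<dots> = (\<Sum>j\<in>I. norm (p j z)) + \<delta> / 2" using N1 by (simp add: sum.distrib N)
    finally have "\<delta> / 2 \<le> (\<Sum>j\<in>I. norm (p j z))" by simp
    then have "(\<delta> / 2)\<^sup>2 \<le> (\<Sum>j\<in>I. norm (p j z))\<^sup>2" using \<delta> by (intro power_mono) auto
    also have "\<dots> \<le> (\<Sum>j\<in>I. (norm (p j z))\<^sup>2) * N" unfolding N by (rule sum_squared_le_sum_of_squares)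
    finally show ?thesis using N1 by (simp add: d pos_divide_le_eq)
  qed
  have F1: "norm (F j i) \<le> 1" if "j \<in> I" for j i
  proof (cases "i \<le> M")
    case True
    show ?thesis by (rule coefficient_bound_circle[OF _ True]) (use p1[OF that] in \<open>simp add: p_def\<close>)
  qed (simp add: F_def)
  have "\<exists>g. (\<forall>j\<in>I. \<forall>t. norm (g j t) \<le> 1) \<and>
    (\<forall>j\<in>I. \<forall>z. norm z < 1 \<longrightarrow> norm (\<Sum>t. g j t * z ^ t) \<le> 1) \<and>
    (\<forall>m\<le>n. (\<Sum>j\<in>I. \<Sum>t\<le>m. F j (m - t) * g j t) = (if m = 0 then of_real c else 0))"
  proof (rule lurking_isometry[OF I(1) c0])
    fix x :: "complex poly" assume x: "\<forall>k\<ge>Suc n. coeff x k = 0"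
    have "(\<Sum>k\<le>n. (cmod (coeff x k))\<^sup>2) \<le>
      4 * a * b * (\<Sum>j\<in>I. \<Sum>k\<le>n. (cmod (\<Sum>i\<le>n. cnj (F j i) * coeff x (k + i)))\<^sup>2)" (is "?X \<le> _ * ?V")
      by (rule polynomial_corona_estimate[OF I d0 _ _ _ x N e a b, where M=M])
         (use p1 pl in \<open>auto simp: F_def p_def\<close>)
    then have "2 * c\<^sup>2 * ?X \<le> 2 * c\<^sup>2 * (4 * a * b * ?V)" by (intro mult_left_mono) auto
    moreover have "c\<^sup>2 = 1 / (8 * a * b)" using a0 b0 by (simp add: c)
    then have "2 * c\<^sup>2 * (4 * a * b) = 1" using a0 b0 by simp
    then have "2 * c\<^sup>2 * (4 * a * b * ?V) = ?V" by (simp only: mult.assoc[symmetric] mult_1)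
    ultimately show "2 * c\<^sup>2 * ?X \<le> ?V" by linarith
  qed
  then obtain g where g1: "\<forall>j\<in>I. \<forall>t. norm (g j t) \<le> 1"
    and g2: "\<forall>j\<in>I. \<forall>z. norm z < 1 \<longrightarrow> norm (\<Sum>t. g j t * z ^ t) \<le> 1"
    and g3: "\<forall>m\<le>n. (\<Sum>j\<in>I. \<Sum>t\<le>m. F j (m - t) * g j t) = (if m = 0 then of_real c else 0)"
    by (elim exE conjE)
  define G where "G j z = (\<Sum>t. g j t * z ^ t)" for j z
  have smb: "summable (\<lambda>t. norm (x t * z ^ t))" if "\<And>t. norm (x t) \<le> 1" "norm z < 1" for x :: "nat \<Rightarrow> complex" and z
  proof (rule summable_comparison_test')
    show "summable (\<lambda>t. norm z ^ t)" using that by (simp add: summable_geometric)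
    show "norm (norm (x t * z ^ t)) \<le> norm z ^ t" for t
      using that(1)[of t] by (simp add: norm_mult norm_power mult_left_le_one_le)
  qed
  have G_hol: "G j holomorphic_on ball 0 1" if "j \<in> I" for j
  proof (rule power_series_holomorphic)
    fix w :: complex assume "w \<in> ball 0 1"
    then have "summable (\<lambda>t. g j t * w ^ t)" using g1 that by (intro summable_norm_cancel[OF smb]) auto
    then show "(\<lambda>t. g j t * (w - 0) ^ t) sums G j w" by (simp add: G_def summable_sums)
  qed
  have err: "norm ((\<Sum>j\<in>I. p j z * G j z) - of_real c) \<le> N * (\<Sum>m. real (Suc (m + Suc n)) * norm z ^ (m + Suc n))"
    if z: "norm z < 1" for z
  proof -
    define E where "E m = (\<Sum>j\<in>I. \<Sum>t\<le>m. F j (m - t) * g j t)" for m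
    have "(\<lambda>m. (\<Sum>t\<le>m. F j (m - t) * g j t) * z ^ m) sums (p j z * G j z)" if j: "j \<in> I" for j
    proof -
      have "(\<Sum>t. F j t * z ^ t) = p j z"
        unfolding p_def by (rule suminf_finite) (auto simp: F_def)
      moreover have "(\<lambda>m. \<Sum>t\<le>m. (g j t * z ^ t) * (F j (m - t) * z ^ (m - t))) sums ((\<Sum>t. g j t * z ^ t) * (\<Sum>t. F j t * z ^ t))"
        using j g1 F1 z by (intro Cauchy_product_sums smb) auto
      moreover have "(\<Sum>t\<le>m. (g j t * z ^ t) * (F j (m - t) * z ^ (m - t))) = (\<Sum>t\<le>m. F j (m - t) * g j t) * z ^ m" for m
        unfolding sum_distrib_right by (intro sum.cong refl) (simp add: mult_ac power_add[symmetric])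
      ultimately show ?thesis by (simp add: G_def mult.commute)
    qed
    then have "(\<lambda>m. \<Sum>j\<in>I. (\<Sum>t\<le>m. F j (m - t) * g j t) * z ^ m) sums (\<Sum>j\<in>I. p j z * G j z)"
      by (intro sums_sum)
    then have Es: "(\<lambda>m. E m * z ^ m) sums (\<Sum>j\<in>I. p j z * G j z)"
      by (simp add: E_def sum_distrib_right)
    \<comment> \<open>All coefficients of the polynomials and of the solutions have modulus at most
      1, so the m-th Cauchy product coefficient is bounded by its number of terms.\<close>
    have E_bound: "norm (E m) \<le> N * real (Suc m)" for m
    proof -
      have "norm (E m) \<le> (\<Sum>j\<in>I. \<Sum>t\<le>m. 1)"
        unfolding E_def
      proof (intro sum_norm_le)
        fix j t assume "j \<in> I"
        then show "norm (F j (m - t) * g j t) \<le> 1" using F1 g1 by (simp add: norm_mult mult_le_one)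
      qed
      then show ?thesis by (simp add: N)
    qed
    have "(\<Sum>m<Suc n. E m * z ^ m) = (\<Sum>m<Suc n. if m = 0 then of_real c else 0)"
      using g3 by (intro sum.cong refl) (auto simp: E_def)
    also have "\<dots> = of_real c" by (simp del: sum.lessThan_Suc)
    finally have init: "(\<Sum>m<Suc n. E m * z ^ m) = of_real c" .
    have "summable (\<lambda>m. E m * z ^ m)" using Es by (simp add: sums_iff)
    from suminf_split_initial_segment[OF this, of "Suc n"]
    have "(\<Sum>j\<in>I. p j z * G j z) - of_real c = (\<Sum>m. E (m + Suc n) * z ^ (m + Suc n))"
      unfolding init using sums_unique[OF Es] by (simp del: power_Suc)
    moreover have "norm (\<Sum>m. E (m + Suc n) * z ^ (m + Suc n)) \<le> (\<Sum>m. N * (real (Suc (m + Suc n)) * norm z ^ (m + Suc n)))"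
    proof (rule norm_suminf_le)
      show "norm (E (m + Suc n) * z ^ (m + Suc n)) \<le> N * (real (Suc (m + Suc n)) * norm z ^ (m + Suc n))" for m
        using mult_right_mono[OF E_bound[of "m + Suc n"], of "norm z ^ (m + Suc n)"]
        by (simp only: norm_mult norm_power mult.assoc) simp
      have "summable (\<lambda>m. real (Suc m) * norm z ^ m)"
        using geometric_deriv_sums[of "norm z"] z by (simp add: sums_iff)
      from summable_ignore_initial_segment[OF this, of "Suc n"]
      show "summable (\<lambda>m. N * (real (Suc (m + Suc n)) * norm z ^ (m + Suc n)))" by (rule summable_mult)
    qed
    moreover have "(\<Sum>m. N * (real (Suc (m + Suc n)) * norm z ^ (m + Suc n))) = N * (\<Sum>m. real (Suc (m + Suc n)) * norm z ^ (m + Suc n))"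
    proof (rule suminf_mult)
      have "summable (\<lambda>m. real (Suc m) * norm z ^ m)"
        using geometric_deriv_sums[of "norm z"] z by (simp add: sums_iff)
      from summable_ignore_initial_segment[OF this, of "Suc n"]
      show "summable (\<lambda>m. real (Suc (m + Suc n)) * norm z ^ (m + Suc n))" .
    qed
    ultimately show ?thesis by (simp only:)
  qed
  show ?thesis
  proof (rule exI[of _ p], rule exI[of _ G], intro conjI ballI allI impI)
    show "norm (p j z - h j (of_real s * z)) < \<epsilon>" if "j \<in> I" "norm z \<le> 1" for j z
      using close[OF that] \<epsilon>'(2) by linarith
    show "G j holomorphic_on ball 0 1" if "j \<in> I" for j by (rule G_hol[OF that])
    show "norm (G j z) \<le> 1" if "j \<in> I" "norm z < 1" for j z using g2 that unfolding G_def by blast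
  qed (rule err)
qed

theorem mainTheorem2:
  fixes N :: nat and f :: "nat \<Rightarrow> complex \<Rightarrow> complex" and \<delta> :: real
  assumes "\<And>j. j \<in> {1..N} \<Longrightarrow> f j \<in> H_infinity"
    and "\<delta> > 0"
    and "\<And>z. z \<in> unit_disc \<Longrightarrow> (\<Sum>j=1..N. cmod (f j z)) \<ge> \<delta>"
  shows "\<exists>g :: nat \<Rightarrow> complex \<Rightarrow> complex.
           (\<forall>j\<in>{1..N}. g j \<in> H_infinity) \<and>
           (\<forall>z\<in>unit_disc. (\<Sum>j=1..N. f j z * g j z) = 1)"
proof -
  define I where "I = {1..N}"
  have I: "finite I" "I \<noteq> {}"
  proof -
    have "\<delta> \<le> (\<Sum>j\<in>I. cmod (f j 0))" using assms(3)[of 0] by (simp add: I_def)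
    then show "I \<noteq> {}" using assms(2) by auto
  qed (simp add: I_def)
  have hol: "f j holomorphic_on ball 0 1" if "j \<in> I" for j
    using assms(1)[of j] that by (simp add: I_def H_infinity_def analytic_on_open)
  have "bounded (\<Union>j\<in>I. f j ` unit_disc)"
    using assms(1) I by (intro bounded_UN) (auto simp: I_def H_infinity_def)
  then obtain M where M: "M > 0" "\<And>j z. j \<in> I \<Longrightarrow> norm z < 1 \<Longrightarrow> norm (f j z) \<le> M"
    unfolding bounded_pos by force
  \<comment> \<open>The additional 2 brings the bound down to 1/2, leaving room for the error of
    polynomial approximation.\<close>
  define h where "h j z = f j z / of_real (2 * M)" for j z
  have hh: "h j holomorphic_on ball 0 1" if "j \<in> I" for j
    unfolding h_def using M(1) by (intro holomorphic_intros hol that) auto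
  have hb: "norm (h j z) \<le> 1 / 2" if "j \<in> I" "norm z < 1" for j z
    using M(1) M(2)[OF that] by (simp add: h_def norm_divide norm_mult field_simps)
  have hl: "\<delta> / (2 * M) \<le> (\<Sum>j\<in>I. norm (h j z))" if "norm z < 1" for z
  proof -
    have "(\<Sum>j\<in>I. norm (h j z)) = (\<Sum>j\<in>I. norm (f j z)) / (2 * M)"
      using M(1) by (simp add: h_def norm_divide norm_mult sum_divide_distrib)
    then show ?thesis using assms(3)[of z] that M(1) by (simp add: I_def divide_right_mono)
  qed
  have \<delta>0: "\<delta> / (2 * M) > 0" using M(1) assms(2) by simp
  define N' where "N' = real (card I)"
  define d where "d = (\<delta> / (2 * M) / 2)\<^sup>2 / N'"
  define e where "e = 1 / d\<^sup>2 + 2 / d ^ 3"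
  define a where "a = N' / d + 17 * e * N'\<^sup>2"
  define b where "b = 1 / d + 4 * N' * e * (17 + 2 * N'\<^sup>2)"
  define c where "c = sqrt (1 / (8 * a * b))"
  have N1: "1 \<le> N'" using I by (simp add: N'_def Suc_leI card_gt_0_iff)
  have d0: "d > 0" using M(1) assms(2) N1 by (simp add: d_def)
  have e0: "e > 0" using d0 by (simp add: e_def add_pos_pos)
  have "a > 0" "b > 0" using d0 e0 N1 by (auto simp: a_def b_def intro!: add_pos_pos mult_pos_pos)
  then have c0: "c > 0" by (simp add: c_def)
  \<comment> \<open>The 2 in the denominator keeps \<open>s 0\<close> positive, so every
    \<open>s n\<close> lies strictly between 0 and 1.\<close>
  define s where "s n = 1 - 1 / (real n + 2)" for n
  define \<epsilon> where "\<epsilon> n = 1 / (real n + 1)" for n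
  define tail where "tail n q = N' * (\<Sum>m. real (Suc (m + Suc n)) * q ^ (m + Suc n))" for n and q :: real
  define \<Phi> where "\<Phi> n p g \<longleftrightarrow> (\<forall>j\<in>I. \<forall>z. norm z \<le> 1 \<longrightarrow> norm (p j z - h j (of_real (s n) * z)) < \<epsilon> n) \<and>
    (\<forall>j\<in>I. g j holomorphic_on ball 0 1) \<and> (\<forall>j\<in>I. \<forall>z. norm z < 1 \<longrightarrow> norm (g j z) \<le> 1) \<and>
    (\<forall>z. norm z < 1 \<longrightarrow> norm ((\<Sum>j\<in>I. p j z * g j z) - of_real c) \<le> tail n (norm z))" for n and p g :: "nat \<Rightarrow> complex \<Rightarrow> complex"
  have "\<exists>p g. \<Phi> n p g" for n
    unfolding \<Phi>_def tail_def
    by (rule corona_approximate_solution[OF I \<delta>0 hh hb hl N'_def d_def e_def a_def b_def c_def])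
       (auto simp: s_def \<epsilon>_def)
  then obtain P G where PG: "\<And>n. \<Phi> n (P n) (G n)" by metis
  have P: "norm (P n j z - h j (of_real (s n) * z)) < \<epsilon> n" if "j \<in> I" "norm z \<le> 1" for n j z
    using PG[of n] that unfolding \<Phi>_def by blast
  have G: "G n j holomorphic_on ball 0 1" if "j \<in> I" for n j
    using PG[of n] that unfolding \<Phi>_def by blast
  have G1: "norm (G n j z) \<le> 1" if "j \<in> I" "z \<in> ball 0 1" for n j z
    using PG[of n] that unfolding \<Phi>_def by auto
  have PG1: "norm ((\<Sum>j\<in>I. P n j z * G n j z) - of_real c) \<le> tail n (norm z)" if "norm z < 1" for n z
    using PG[of n] that unfolding \<Phi>_def by blast
  have "\<exists>r::nat \<Rightarrow> nat. strict_mono r \<and> (\<forall>j\<in>I. \<exists>g. g holomorphic_on ball 0 1 \<and> (\<forall>z\<in>ball 0 1. (\<lambda>n. G (r n) j z) \<longlonglongrightarrow> g z))"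
    by (rule montel_finite_family[OF I(1) open_ball, where B=1]) (use G G1 in auto)
  then obtain r :: "nat \<Rightarrow> nat" where r: "strict_mono r"
    and ex: "\<forall>j\<in>I. \<exists>g. g holomorphic_on ball 0 1 \<and> (\<forall>z\<in>ball 0 1. (\<lambda>n. G (r n) j z) \<longlonglongrightarrow> g z)"
    by (elim exE conjE)
  from bchoice[OF ex] obtain g where g: "\<And>j. j \<in> I \<Longrightarrow> g j holomorphic_on ball 0 1"
    and lim: "\<And>j z. j \<in> I \<Longrightarrow> z \<in> ball 0 1 \<Longrightarrow> (\<lambda>n. G (r n) j z) \<longlonglongrightarrow> g j z"
    by blast
  have g1: "norm (g j z) \<le> 1" if "j \<in> I" "z \<in> ball 0 1" for j z
    by (rule LIMSEQ_le_const2[OF tendsto_norm[OF lim[OF that]]]) (use G1[OF that] in auto)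
  have Plim: "(\<lambda>n. P n j z) \<longlonglongrightarrow> h j z" if j: "j \<in> I" and z: "z \<in> ball 0 1" for j z
  proof -
    have "s \<longlonglongrightarrow> 1 - 0" unfolding s_def
      by (intro tendsto_intros tendsto_divide_0[OF tendsto_const] filterlim_at_top_imp_at_infinity
          filterlim_tendsto_add_at_top[OF tendsto_const filterlim_real_sequentially, of 2, simplified add.commute])
    then have "(\<lambda>n. of_real (s n) * z) \<longlonglongrightarrow> of_real 1 * z" by (intro tendsto_intros) simp
    moreover have "isCont (h j) z"
      using holomorphic_on_imp_continuous_on[OF hh[OF j]] z by (intro continuous_on_interior) (auto simp: interior_open)
    ultimately have "(\<lambda>n. h j (of_real (s n) * z)) \<longlonglongrightarrow> h j z"
      by (intro isCont_tendsto_compose[of z "h j"]) auto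
    moreover have "(\<lambda>n. P n j z - h j (of_real (s n) * z)) \<longlonglongrightarrow> 0"
    proof (rule Lim_null_comparison)
      show "\<forall>\<^sub>F n in sequentially. norm (P n j z - h j (of_real (s n) * z)) \<le> \<epsilon> n"
        using P[OF j, of z] z by (intro always_eventually allI less_imp_le) auto
      show "\<epsilon> \<longlonglongrightarrow> 0" unfolding \<epsilon>_def using LIMSEQ_inverse_real_of_nat by (simp add: inverse_eq_divide add.commute)
    qed
    ultimately show ?thesis using tendsto_add by fastforce
  qed
  have eq: "(\<Sum>j\<in>I. h j z * g j z) = of_real c" if z: "z \<in> ball 0 1" for z
  proof (rule LIMSEQ_unique)
    show "(\<lambda>n. \<Sum>j\<in>I. P (r n) j z * G (r n) j z) \<longlonglongrightarrow> (\<Sum>j\<in>I. h j z * g j z)"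
      using LIMSEQ_subseq_LIMSEQ[OF Plim[OF _ z] r] lim[OF _ z] by (intro tendsto_intros) (auto simp: o_def)
    have "summable (\<lambda>m. real (Suc m) * norm z ^ m)"
      using geometric_deriv_sums[of "norm z"] z by (simp add: sums_iff)
    \<comment> \<open>For fixed \<open>z\<close> the error bound is a multiple of the tail of a
      convergent series, so pointwise limits suffice for the equation.\<close>
    from LIMSEQ_Suc[OF suminf_exist_split2[OF this]]
    have "(\<lambda>n. tail n (norm z)) \<longlonglongrightarrow> N' * 0" unfolding tail_def by (intro tendsto_intros)
    then have "(\<lambda>n. tail (r n) (norm z)) \<longlonglongrightarrow> 0" using LIMSEQ_subseq_LIMSEQ[OF _ r] by (fastforce simp: o_def)
    then have "(\<lambda>n. (\<Sum>j\<in>I. P (r n) j z * G (r n) j z) - of_real c) \<longlonglongrightarrow> 0"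
      by (rule Lim_null_comparison[rotated]) (use PG1 z in auto)
    then show "(\<lambda>n. \<Sum>j\<in>I. P (r n) j z * G (r n) j z) \<longlonglongrightarrow> of_real c"
      by (simp add: LIM_zero_iff)
  qed
  show ?thesis
  \<comment> \<open>The limit functions solve the equation for f_j / (2M) with right-hand side
    \<open>c\<close>; dividing by 2Mc undoes both normalisations.\<close>
  proof (intro exI[of _ "\<lambda>j z. g j z / of_real (2 * M * c)"] conjI ballI)
    fix j assume "j \<in> {1..N}"
    then have j: "j \<in> I" by (simp add: I_def)
    have "(\<lambda>z. g j z / of_real (2 * M * c)) holomorphic_on ball 0 1"
      using M(1) c0 by (intro holomorphic_intros g j) auto
    moreover have "bounded ((\<lambda>z. g j z / of_real (2 * M * c)) ` unit_disc)"
      using M(1) c0 g1[OF j]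
      by (intro boundedI[of _ "1 / (2 * M * c)"]) (auto simp: norm_divide norm_mult divide_right_mono)
    ultimately show "(\<lambda>z. g j z / of_real (2 * M * c)) \<in> H_infinity"
      by (simp add: H_infinity_def analytic_on_open)
  next
    fix z :: complex assume z: "z \<in> unit_disc"
    have "(\<Sum>j\<in>I. f j z * (g j z / of_real (2 * M * c))) = (\<Sum>j\<in>I. h j z * g j z) / of_real c"
      using M(1) c0 by (simp add: h_def sum_divide_distrib)
    also have "\<dots> = 1" using eq[OF z] c0 by simp
    finally show "(\<Sum>j=1..N. f j z * (g j z / of_real (2 * M * c))) = 1" by (simp add: I_def)
  qed
qed



end
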